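(* Let $z\in U$ be arbitrary. Then there exists a unique basic subset $D\subseteq\Phi$ and a unique map $\phi:D\to\mathbb{F}_q^\times$ such that $z\in K_{D,\phi}$. Thus $U$ is the disjoint union of all its superclasses, $U=\bigcup_{D,\phi}K_{D,\phi}$, where the union runs over all basic pairs $(D,\phi)$ for $U$.
   Context: Let $p$ be an odd prime, $q=p^{e}$ ($e\ge 1$), $\mathbb{F}_q$ the field with $q$ elements, $\mathbb{F}_q^{\times}=\mathbb{F}_q\setminus\{0\}$, and $n\ge 1$. Let $G$ be one of $Sp_{2n}(q)$, $O_{2n}(q)$, $O_{2n+1}(q)$; put $m=2n$ in the first two cases and $m=2n+1$ in the third. $U_m(q)$ is the group of unipotent upper-triangular $m\times m$ matrices over $\mathbb{F}_q$, and $U=G\cap U_m(q)$. Explicitly, with $J$ the $n\times n$ matrix with $1$'s on the anti-diagonal and $0$'s elsewhere, $U$ consists of all block matrices $\begin{pmatrix} x & xv & xw\\ 0 & I_r & -v^{T}J\\ 0&0&Jx^{-T}J\end{pmatrix}$ with $x\in U_n(q)$, $v$ an $n\times r$ matrix, $w$ an $n\times n$ matrix over $\mathbb{F}_q$, where: $r=0$ and $Jw^T-wJ=0$ if $G=Sp_{2n}(q)$; $r=0$ and $Jw^T+wJ=0$ if $G=O_{2n}(q)$; $r=1$ and $Jw^T+wJ=-vv^T$ if $G=O_{2n+1}(q)$. Indexing. Rows and columns of $m\times m$ matrices are indexed by $1\prec 2\prec\cdots\prec n\prec 0\prec -n\prec\cdots\prec -2\prec -1$ (index $0$ present only if $G=O_{2n+1}(q)$);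 $e_{i,j}$ denotes a matrix unit. Roots. $\varepsilon_1,\dots,\varepsilon_n$ are formal independent symbols; $\Phi=\{\varepsilon_i\pm\varepsilon_j:1\le i<j\le n\}\cup\Phi'$ with $\Phi'=\{2\varepsilon_i:1\le i\le n\}$ if $G=Sp_{2n}(q)$, $\Phi'=\emptyset$ if $G=O_{2n}(q)$, $\Phi'=\{\varepsilon_i:1\le i\le n\}$ if $G=O_{2n+1}(q)$. For $\alpha\in\Phi$ let $\mathcal{E}(\alpha)$ be: $\{(i,j),(-j,-i)\}$ if $\alpha=\varepsilon_i-\varepsilon_j$; $\{(i,-j),(j,-i)\}$ if $\alpha=\varepsilon_i+\varepsilon_j$ ($i<j$); $\{(i,-i)\}$ if $\alpha=2\varepsilon_i$; $\{(i,0),(0,-i)\}$ if $\alpha=\varepsilon_i$. For $\Psi\subseteq\Phi$, $\mathcal{E}(\Psi)=\bigcup_{\alpha\in\Psi}\mathcal{E}(\alpha)$. Basic pairs. $D\subseteq\Phi$ is basic if $\mathcal{E}(D)$ contains at most one entry from each row and at most one from each column. A basic pair for $U$ is $(D,\phi)$ with $D\subseteq\Phi$ basic (possibly empty) and $\phi:D\to\mathbb{F}_q^\times$ a map. Superclasses. Let $e_\alpha$ be: $e_{i,j}-e_{-j,-i}$ if $\alpha=\varepsilon_i-\varepsilon_j$; $e_{i,-j}+e_{j,-i}$ if $\alpha=\varepsilon_i+\varepsilon_j$ and $G=Sp_{2n}(q)$; $e_{i,-j}-e_{j,-i}$ if $\alpha=\varepsilon_i+\varepsilon_j$ and $G$ is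 orthogonal; $e_{i,-i}$ if $\alpha=2\varepsilon_i$; $e_{i,0}-e_{0,-i}$ if $\alpha=\varepsilon_i$. Put $e_{D,\phi}=\sum_{\alpha\in D}\phi(\alpha)e_\alpha$, $V_{D,\phi}=U_m(q)\,e_{D,\phi}\,U_m(q)$ and $K_{D,\phi}=\{x\in U: x-1\in V_{D,\phi}\}$ (so $K_{D,\phi}=\{1\}$ if $D=\emptyset$). The sets $K_{D,\phi}$ are the superclasses of $U$. *)

theory Defs
  imports
    "Jordan_Normal_Form.Matrix"
    "HOL-Library.FuncSet"
    "HOL-Library.Disjoint_Sets"
    "HOL-Computational_Algebra.Primes"
begin

text \<open>
  The field with q elements is a type of classes \<^class>\<open>field\<close> and \<^class>\<open>finite\<close>; its cardinality
  is prescribed in the theorem. \<open>Sp\<close>, \<open>O_even\<close>, \<open>O_odd\<close> stand for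
  the families \<open>Sp\<^sub>2\<^sub>n(q)\<close>, \<open>O\<^sub>2\<^sub>n(q)\<close>, \<open>O\<^sub>2\<^sub>n\<^sub>+\<^sub>1(q)\<close>.
\<close>

datatype family = Sp | O_even | O_odd

text \<open>The number r of middle rows and columns of the block decomposition.\<close>

definition mid :: "family \<Rightarrow> nat" where
  "mid G = (case G of Sp \<Rightarrow> 0 | O_even \<Rightarrow> 0 | O_odd \<Rightarrow> 1)"

definition msize :: "family \<Rightarrow> nat \<Rightarrow> nat" where
  "msize G n = 2 * n + mid G"

subsection \<open>The unipotent groups\<close>

definition unitriangular :: "nat \<Rightarrow> 'a::field mat set" where
  "unitriangular m = {x \<in> carrier_mat m m. upper_triangular x \<and> (\<forall>i<m. x $$ (i, i) = 1)}"

definition antidiag :: "nat \<Rightarrow> 'a::field mat" where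
  "antidiag n = mat n n (\<lambda>(i, j). if i + j = n - 1 then 1 else 0)"

text \<open>
  The 3 by 3 block matrix with rows \<open>(x, x v, x w)\<close>, \<open>(0, 1, - v\<^sup>T J)\<close> and \<open>(0, 0, J y\<^sup>T J)\<close>, where
  v is an n by r matrix and y plays the part of the inverse of x. The upper left \<open>(n + r) \<times> (n + r)\<close>
  corner is grouped into one block; for r = 0 the middle row and column are empty.
\<close>

definition block_elt ::
  "nat \<Rightarrow> nat \<Rightarrow> 'a::field mat \<Rightarrow> 'a mat \<Rightarrow> 'a mat \<Rightarrow> 'a mat \<Rightarrow> 'a mat" where
  "block_elt n r x y v w =
     four_block_mat
       (four_block_mat x (x * v) (0\<^sub>m r n) (1\<^sub>m r))
       ((x * w) @\<^sub>r (- (transpose_mat v * antidiag n)))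
       (0\<^sub>m n (n + r))
       (antidiag n * transpose_mat y * antidiag n)"

definition w_condition :: "family \<Rightarrow> nat \<Rightarrow> 'a::field mat \<Rightarrow> 'a mat \<Rightarrow> bool" where
  "w_condition G n v w =
     (case G of
        Sp \<Rightarrow> antidiag n * transpose_mat w - w * antidiag n = 0\<^sub>m n n
      | O_even \<Rightarrow> antidiag n * transpose_mat w + w * antidiag n = 0\<^sub>m n n
      | O_odd \<Rightarrow> antidiag n * transpose_mat w + w * antidiag n = - (v * transpose_mat v))"

definition unip_group :: "family \<Rightarrow> nat \<Rightarrow> 'a::field mat set" where
  "unip_group G n =
     {block_elt n (mid G) x y v w | x y v w.
        x \<in> unitriangular n \<and>
        y \<in> carrier_mat n n \<and> inverts_mat x y \<and> inverts_mat y x \<and>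
        v \<in> carrier_mat n (mid G) \<and> w \<in> carrier_mat n n \<and>
        w_condition G n v w}"

subsection \<open>Roots and basic pairs\<close>

text \<open>
  Since the symbols \<open>\<epsilon>\<^sub>i\<close> are independent, the formal expressions \<open>\<epsilon>\<^sub>i - \<epsilon>\<^sub>j\<close>, \<open>\<epsilon>\<^sub>i + \<epsilon>\<^sub>j\<close> (i < j),
  \<open>2 \<epsilon>\<^sub>i\<close> and \<open>\<epsilon>\<^sub>i\<close> are pairwise distinct, so they are represented by free constructors.
\<close>

datatype root = EpsMinus int int | EpsPlus int int | TwoEps int | Eps int

definition roots :: "family \<Rightarrow> nat \<Rightarrow> root set" where
  "roots G n =
     {EpsMinus i j | i j. 1 \<le> i \<and> i < j \<and> j \<le> int n} \<union>
     {EpsPlus i j | i j. 1 \<le> i \<and> i < j \<and> j \<le> int n} \<union>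
     (case G of
        Sp \<Rightarrow> {TwoEps i | i. 1 \<le> i \<and> i \<le> int n}
      | O_even \<Rightarrow> {}
      | O_odd \<Rightarrow> {Eps i | i. 1 \<le> i \<and> i \<le> int n})"

fun entries :: "root \<Rightarrow> (int \<times> int) set" where
  "entries (EpsMinus i j) = {(i, j), (- j, - i)}"
| "entries (EpsPlus i j) = {(i, - j), (j, - i)}"
| "entries (TwoEps i) = {(i, - i)}"
| "entries (Eps i) = {(i, 0), (0, - i)}"

definition entries_of :: "root set \<Rightarrow> (int \<times> int) set" where
  "entries_of \<Psi> = (\<Union>\<alpha>\<in>\<Psi>. entries \<alpha>)"

definition basic :: "root set \<Rightarrow> bool" where
  "basic D \<longleftrightarrow>
     (\<forall>i j k. (i, j) \<in> entries_of D \<and> (i, k) \<in> entries_of D \<longrightarrow> j = k) \<and>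
     (\<forall>i j k. (i, k) \<in> entries_of D \<and> (j, k) \<in> entries_of D \<longrightarrow> i = j)"

text \<open>
  A map from D to the nonzero field elements is an extensional function, so that it is determined
  by its values on D.
\<close>

definition basic_pairs :: "family \<Rightarrow> nat \<Rightarrow> (root set \<times> (root \<Rightarrow> 'a::field)) set" where
  "basic_pairs G n = {(D, \<phi>). D \<subseteq> roots G n \<and> basic D \<and> \<phi> \<in> D \<rightarrow>\<^sub>E (UNIV - {0})}"

subsection \<open>Superclasses\<close>

text \<open>
  Position (counted from 0) of a row or column index in the order
  \<open>1, 2, \<dots>, n, 0, - n, \<dots>, - 2, - 1\<close>, where 0 occurs only for \<open>O_odd\<close>.
\<close>

definition pos :: "family \<Rightarrow> nat \<Rightarrow> int \<Rightarrow> nat" where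
  "pos G n i =
     (if i > 0 then nat (i - 1)
      else if i = 0 then n
      else nat (int (msize G n) + i))"

definition e_unit :: "family \<Rightarrow> nat \<Rightarrow> int \<Rightarrow> int \<Rightarrow> 'a::field mat" where
  "e_unit G n i j =
     mat (msize G n) (msize G n) (\<lambda>(k, l). if k = pos G n i \<and> l = pos G n j then 1 else 0)"

fun e_root :: "family \<Rightarrow> nat \<Rightarrow> root \<Rightarrow> 'a::field mat" where
  "e_root G n (EpsMinus i j) = e_unit G n i j - e_unit G n (- j) (- i)"
| "e_root G n (EpsPlus i j) =
     (if G = Sp then e_unit G n i (- j) + e_unit G n j (- i)
      else e_unit G n i (- j) - e_unit G n j (- i))"
| "e_root G n (TwoEps i) = e_unit G n i (- i)"
| "e_root G n (Eps i) = e_unit G n i 0 - e_unit G n 0 (- i)"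

text \<open>The sum over D is written entrywise, as matrices of a given size are not a type.\<close>

definition e_pair :: "family \<Rightarrow> nat \<Rightarrow> root set \<Rightarrow> (root \<Rightarrow> 'a::field) \<Rightarrow> 'a mat" where
  "e_pair G n D \<phi> =
     mat (msize G n) (msize G n) (\<lambda>(k, l). \<Sum>\<alpha>\<in>D. (\<phi> \<alpha> \<cdot>\<^sub>m e_root G n \<alpha>) $$ (k, l))"

definition double_orbit :: "family \<Rightarrow> nat \<Rightarrow> root set \<Rightarrow> (root \<Rightarrow> 'a::field) \<Rightarrow> 'a mat set" where
  "double_orbit G n D \<phi> =
     {a * e_pair G n D \<phi> * b | a b.
        a \<in> unitriangular (msize G n) \<and> b \<in> unitriangular (msize G n)}"

definition superclass :: "family \<Rightarrow> nat \<Rightarrow> root set \<Rightarrow> (root \<Rightarrow> 'a::field) \<Rightarrow> 'a mat set" where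
  "superclass G n D \<phi> =
     {x \<in> unip_group G n. x - 1\<^sub>m (msize G n) \<in> double_orbit G n D \<phi>}"

end

theory Submission
  imports Defs "Jordan_Normal_Form.Determinant" "HOL-Number_Theory.Residues"
begin

text \<open>
  Every square matrix lies in exactly one double coset \<open>U\<^sub>m M U\<^sub>m\<close> of the unitriangular group with M
  monomial, i.e. with at most one nonzero entry in each row and in each column. Let \<open>\<dagger>\<close> be the
  antiautomorphism of matrices, transposition in the antidiagonal up to signs, for which the elements
  of G satisfy \<open>z z\<^sup>\<dagger> = 1\<close>. For z in U and \<open>N = z - 1\<close> this gives \<open>N\<^sup>\<dagger> = - N z\<^sup>\<dagger>\<close>, so \<open>N\<^sup>\<dagger>\<close> and \<open>- N\<close> lie in the same
  double coset. Hence the monomial representative M of N satisfies \<open>M\<^sup>\<dagger> = - M\<close>, and it is strictly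
  upper triangular. In odd characteristic such matrices M are exactly the \<open>e\<^sub>D\<^sub>,\<^sub>\<phi>\<close>, each for a unique
  basic pair.
\<close>

subsection \<open>Double cosets of the unitriangular group\<close>

text \<open>The elimination that produces M ignores the bilinear form: it uses arbitrary row and
  column operations from the full group \<open>unitriangular m\<close>, which is also the group that
  cuts out the superclasses. No symmetry is maintained on the way. It is recovered afterwards from
  uniqueness alone: \<dagger> reverses products and preserves unitriangular matrices, hence carries
  the double coset of M to that of its image, and two monomial matrices in one double coset
  coincide. The same uniqueness separates the superclasses, so it carries both halves of the
  theorem. It is proved for the one-sided relation \<open>a * M = M' * b\<close>, because left
  multiplication by a acts within columns and right multiplication by b within rows, so that each
  side shows the pivots of its own monomial factor.\<close>

lemma index_mult_square:
  assumes "A \<in> carrier_mat m m" "B \<in> carrier_mat m m" "i < m" "j < m"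
  shows "(A * B) $$ (i, j) = (\<Sum>k = 0..<m. A $$ (i, k) * B $$ (k, j))"
  using assms by (auto simp: scalar_prod_def)

lemma unitriangularD:
  assumes "x \<in> unitriangular m"
  shows "x \<in> carrier_mat m m"
    and "\<And>i j. j < i \<Longrightarrow> i < m \<Longrightarrow> x $$ (i, j) = 0"
    and "\<And>i. i < m \<Longrightarrow> x $$ (i, i) = 1"
  using assms by (auto simp: unitriangular_def upper_triangular_def)

lemma unitriangularI:
  assumes "x \<in> carrier_mat m m"
    and "\<And>i j. j < i \<Longrightarrow> i < m \<Longrightarrow> x $$ (i, j) = 0"
    and "\<And>i. i < m \<Longrightarrow> x $$ (i, i) = 1"
  shows "x \<in> unitriangular m"
  using assms by (auto simp: unitriangular_def upper_triangular_def)

lemma one_unitriangular: "1\<^sub>m m \<in> unitriangular m"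
  by (auto intro!: unitriangularI)

lemma mult_unitriangular:
  assumes x: "x \<in> unitriangular m" and y: "y \<in> unitriangular m"
  shows "x * y \<in> unitriangular m"
proof (rule unitriangularI)
  note X = unitriangularD[OF x] and Y = unitriangularD[OF y]
  show "x * y \<in> carrier_mat m m" using X(1) Y(1) by auto
  show "(x * y) $$ (i, j) = 0" if "j < i" "i < m" for i j
  proof -
    have "x $$ (i, k) * y $$ (k, j) = 0" if "k < m" for k
      using X(2)[of k i] Y(2)[of j k] \<open>j < i\<close> \<open>i < m\<close> that by (cases "k < i") auto
    then show ?thesis
      using that by (subst index_mult_square[OF X(1) Y(1)]) (auto intro: sum.neutral)
  qed
  show "(x * y) $$ (i, i) = 1" if "i < m" for i
  proof -
    have "x $$ (i, k) * y $$ (k, i) = (if k = i then 1 else 0)" if "k < m" for k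
      using X(2)[of k i] Y(2)[of i k] X(3) Y(3) \<open>i < m\<close> that
      by (cases k i rule: linorder_cases) auto
    then show ?thesis
      using that index_mult_square[OF X(1) Y(1)] by simp
  qed
qed

text \<open>The determinant is 1, so some two-sided inverse exists. Its shape is read off from
  \<open>x * y = 1\<^sub>m m\<close> going upwards through the rows: row i of this equation
  expresses row i of y by the rows of y below it.\<close>

lemma unitriangular_inverse:
  assumes x: "x \<in> unitriangular m"
  obtains y where "y \<in> unitriangular m" "x * y = 1\<^sub>m m" "y * x = 1\<^sub>m m"
proof -
  note X = unitriangularD[OF x]
  have "diag_mat x = replicate m 1"
    using X by (auto simp: diag_mat_def intro!: nth_equalityI)
  then have "det x = 1"
    using det_upper_triangular[of x m] x by (simp add: unitriangular_def)
  then have "x \<in> Units (ring_mat TYPE('a) m ())"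
    using det_non_zero_imp_unit[OF X(1)] by simp
  then obtain y where y: "y \<in> carrier_mat m m" "x * y = 1\<^sub>m m" "y * x = 1\<^sub>m m"
    unfolding Units_def by (auto simp: ring_mat_simps)
  have entry: "(if i = j then 1 else 0) = y $$ (i, j) + (\<Sum>k \<in> {i<..<m}. x $$ (i, k) * y $$ (k, j))"
    if "i < m" "j < m" for i j
  proof -
    have "(if i = j then 1 else 0) = (\<Sum>k = 0..<m. x $$ (i, k) * y $$ (k, j))"
      using that index_mult_square[OF X(1) y(1) that] y(2) by simp
    also have "\<dots> = (\<Sum>k \<in> insert i {i<..<m}. x $$ (i, k) * y $$ (k, j))"
      using that X(2) by (intro sum.mono_neutral_right) auto
    also have "\<dots> = y $$ (i, j) + (\<Sum>k \<in> {i<..<m}. x $$ (i, k) * y $$ (k, j))"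
      using X(3) that by simp
    finally show ?thesis .
  qed
  have lower: "y $$ (i, j) = 0" if "j < i" "i < m" for i j
    using that
  proof (induction "m - i" arbitrary: i rule: less_induct)
    case less
    have "y $$ (k, j) = 0" if "i < k" "k < m" for k
      using less.hyps[of k] less.prems that by auto
    then show ?case
      using entry[of i j] less.prems by simp
  qed
  have "y $$ (i, i) = 1" if "i < m" for i
    using entry[of i i] lower that by simp
  with y lower show ?thesis
    by (intro that[of y] unitriangularI) auto
qed

section \<open>Uniqueness of the monomial matrix in a double coset\<close>

definition monomial_mat :: "nat \<Rightarrow> 'a::zero mat \<Rightarrow> bool" where
  "monomial_mat m M \<longleftrightarrow> M \<in> carrier_mat m m \<and>
     (\<forall>i<m. \<forall>j<m. \<forall>k<m. M $$ (i, j) \<noteq> 0 \<and> M $$ (i, k) \<noteq> 0 \<longrightarrow> j = k) \<and>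
     (\<forall>i<m. \<forall>j<m. \<forall>k<m. M $$ (i, k) \<noteq> 0 \<and> M $$ (j, k) \<noteq> 0 \<longrightarrow> i = j)"

lemma monomial_matD:
  assumes "monomial_mat m M"
  shows "M \<in> carrier_mat m m"
    and "\<And>i j k. i < m \<Longrightarrow> j < m \<Longrightarrow> k < m \<Longrightarrow> M $$ (i, j) \<noteq> 0 \<Longrightarrow> M $$ (i, k) \<noteq> 0 \<Longrightarrow> j = k"
    and "\<And>i j k. i < m \<Longrightarrow> j < m \<Longrightarrow> k < m \<Longrightarrow> M $$ (i, k) \<noteq> 0 \<Longrightarrow> M $$ (j, k) \<noteq> 0 \<Longrightarrow> i = j"
proof -
  note D = assms[unfolded monomial_mat_def]
  show "M \<in> carrier_mat m m" using D by (rule conjunct1)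
  show "j = k" if "i < m" "j < m" "k < m" "M $$ (i, j) \<noteq> 0" "M $$ (i, k) \<noteq> 0" for i j k
    using D[THEN conjunct2, THEN conjunct1, rule_format, OF that(1-3)] that(4,5) by simp
  show "i = j" if "i < m" "j < m" "k < m" "M $$ (i, k) \<noteq> 0" "M $$ (j, k) \<noteq> 0" for i j k
    using D[THEN conjunct2, THEN conjunct2, rule_format, OF that(1-3)] that(4,5) by simp
qed

lemma unitriangular_mult_column:
  assumes "a \<in> unitriangular m" "A \<in> carrier_mat m m" "i < m" "j < m"
    and "\<And>k. k < m \<Longrightarrow> k \<noteq> i \<Longrightarrow> A $$ (k, j) = 0" "l < m"
  shows "(a * A) $$ (l, j) = a $$ (l, i) * A $$ (i, j)"
proof -
  have "(a * A) $$ (l, j) = (\<Sum>k = 0..<m. a $$ (l, k) * A $$ (k, j))"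
    using assms index_mult_square unitriangularD(1) by blast
  also have "\<dots> = (\<Sum>k \<in> {i}. a $$ (l, k) * A $$ (k, j))"
    using assms by (intro sum.mono_neutral_right) auto
  finally show ?thesis by simp
qed

lemma unitriangular_mult_row:
  assumes "b \<in> unitriangular m" "A \<in> carrier_mat m m" "i < m" "j < m"
    and "\<And>k. k < m \<Longrightarrow> k \<noteq> j \<Longrightarrow> A $$ (i, k) = 0" "l < m"
  shows "(A * b) $$ (i, l) = A $$ (i, j) * b $$ (j, l)"
proof -
  have "(A * b) $$ (i, l) = (\<Sum>k = 0..<m. A $$ (i, k) * b $$ (k, l))"
    using assms index_mult_square unitriangularD(1) by blast
  also have "\<dots> = (\<Sum>k \<in> {j}. A $$ (i, k) * b $$ (k, l))"
    using assms by (intro sum.mono_neutral_right) auto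
  finally show ?thesis by simp
qed

text \<open>
  A nonzero entry of M is the lowest nonzero entry of its column in \<open>a * M\<close>, and a nonzero entry of
  M' is the leftmost nonzero entry of its row in \<open>M' * b\<close>.
\<close>

lemma monomial_entry_eq:
  assumes a: "a \<in> unitriangular m" and b: "b \<in> unitriangular m"
    and M: "monomial_mat m M" and M': "monomial_mat m M'"
    and eq: "a * M = M' * b"
    and "i < m" "j < m" "M $$ (i, j) \<noteq> 0"
  shows "M' $$ (i, j) = M $$ (i, j)"
  using assms(6-8)
proof (induction j arbitrary: i rule: less_induct)
  case (less j)
  note A = unitriangularD[OF a] and B = unitriangularD[OF b]
  note m = monomial_matD[OF M] and m' = monomial_matD[OF M']
  have "(a * M) $$ (i, j) = a $$ (i, i) * M $$ (i, j)"
    using unitriangular_mult_column[OF a m(1), of i j i] m(3) less.prems by blast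
  then have aM: "(M' * b) $$ (i, j) = M $$ (i, j)"
    using A(3) less.prems eq by simp
  have "\<exists>l<m. M' $$ (i, l) \<noteq> 0"
  proof (rule ccontr)
    assume "\<not> ?thesis"
    then have "(M' * b) $$ (i, j) = 0"
      using less.prems index_mult_square[OF m'(1) B(1)] by simp
    with aM less.prems show False by simp
  qed
  then obtain l where l: "l < m" "M' $$ (i, l) \<noteq> 0" by blast
  have row: "(M' * b) $$ (i, k) = M' $$ (i, l) * b $$ (l, k)" if "k < m" for k
    using unitriangular_mult_row[OF b m'(1), of i l k] m'(2) less.prems l that by blast
  have "l \<le> j"
    using row[of j] aM B(2)[of j l] less.prems l by (cases "l \<le> j") auto
  \<comment> \<open>If l were smaller than j, column l of \<open>a * M\<close> would be nonzero, so
    M would have a pivot in column l. The induction hypothesis copies it to M', where column l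
    already has its entry in row i. Then M has two nonzero entries in row i.\<close>
  moreover have False if "l < j"
  proof -
    have aMl: "(a * M) $$ (i, l) \<noteq> 0"
      using row[of l] B(3) l eq by simp
    have "\<exists>k<m. M $$ (k, l) \<noteq> 0"
    proof (rule ccontr)
      assume "\<not> ?thesis"
      then have "(a * M) $$ (i, l) = 0"
        using less.prems l index_mult_square[OF A(1) m(1)] by simp
      with aMl show False by simp
    qed
    then obtain k where k: "k < m" "M $$ (k, l) \<noteq> 0" by blast
    then have "M' $$ (k, l) \<noteq> 0"
      using less.IH[of l k] that l by simp
    then have "k = i" using m'(3)[of k i l] k l less.prems by blast
    then show False using m(2)[of i l j] k l less.prems that by blast
  qed
  ultimately have "l = j" by fastforce
  then show ?case using row[of j] aM B(3) l by simp
qed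

text \<open>\<open>monomial_entry_eq\<close> only says that nonzero entries of M reappear in M'.
  Inverting a and b turns the relation into \<open>a' * M' = M * b'\<close>, so the roles can be
  exchanged, and this settles the zero entries as well.\<close>

lemma monomial_unique:
  assumes a: "a \<in> unitriangular m" and b: "b \<in> unitriangular m"
    and M: "monomial_mat m M" and M': "monomial_mat m M'"
    and eq: "a * M = M' * b"
  shows "M = M'"
proof (rule eq_matI)
  obtain a' where a': "a' \<in> unitriangular m" "a' * a = 1\<^sub>m m"
    using unitriangular_inverse[OF a] by metis
  obtain b' where b': "b' \<in> unitriangular m" "b * b' = 1\<^sub>m m"
    using unitriangular_inverse[OF b] by metis
  note c = unitriangularD(1)[OF a] unitriangularD(1)[OF b] unitriangularD(1)[OF a'(1)]
    unitriangularD(1)[OF b'(1)] monomial_matD(1)[OF M] monomial_matD(1)[OF M']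
  have "M * b' = a' * a * M * b'" using a' c by simp
  also have "\<dots> = a' * (a * M) * b'" using c by simp
  also have "\<dots> = a' * M' * (b * b')" unfolding eq using c by (simp add: assoc_mult_mat[of _ m m _ m _ m])
  also have "\<dots> = a' * M'" using b' c by simp
  finally have eq': "a' * M' = M * b'" by simp
  fix i j assume "i < dim_row M'" "j < dim_col M'"
  then have "i < m" "j < m" using c by auto
  then show "M $$ (i, j) = M' $$ (i, j)"
    using monomial_entry_eq[OF a b M M' eq, of i j] monomial_entry_eq[OF a'(1) b'(1) M' M eq', of i j]
    by metis
qed (use M M' in \<open>auto simp: monomial_mat_def\<close>)

section \<open>Existence of the monomial matrix by elimination, column by column\<close>

definition reduced_upto :: "nat \<Rightarrow> nat \<Rightarrow> 'a::zero mat \<Rightarrow> bool" where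
  "reduced_upto m t Y \<longleftrightarrow> Y \<in> carrier_mat m m \<and>
     (\<forall>j<t. \<forall>i<m. j < m \<and> Y $$ (i, j) \<noteq> 0 \<longrightarrow>
        (\<forall>k<m. k \<noteq> j \<longrightarrow> Y $$ (i, k) = 0) \<and> (\<forall>k<m. k \<noteq> i \<longrightarrow> Y $$ (k, j) = 0))"

lemma reduced_upto_carrier: "reduced_upto m t Y \<Longrightarrow> Y \<in> carrier_mat m m"
  unfolding reduced_upto_def by (rule conjunct1)

lemma reduced_uptoD:
  assumes "reduced_upto m t Y" "j < t" "j < m" "i < m" "Y $$ (i, j) \<noteq> 0" "k < m"
  shows "k \<noteq> j \<Longrightarrow> Y $$ (i, k) = 0" and "k \<noteq> i \<Longrightarrow> Y $$ (k, j) = 0"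
  using assms(1)[unfolded reduced_upto_def, THEN conjunct2, rule_format, OF assms(2,4)] assms(3,5,6)
  by simp_all

lemma reduced_upto_monomial:
  assumes "reduced_upto m m M"
  shows "monomial_mat m M"
  unfolding monomial_mat_def
proof (intro conjI allI impI)
  show "M \<in> carrier_mat m m" using reduced_upto_carrier[OF assms] .
  fix i j k assume "i < m" "j < m" "k < m"
  then show "M $$ (i, j) \<noteq> 0 \<and> M $$ (i, k) \<noteq> 0 \<Longrightarrow> j = k"
    and "M $$ (i, k) \<noteq> 0 \<and> M $$ (j, k) \<noteq> 0 \<Longrightarrow> i = j"
    using reduced_uptoD(1)[OF assms, of j i k] reduced_uptoD(2)[OF assms, of k i j] by argo+
qed

text \<open>The invariant \<open>reduced_upto\<close> requires a nonzero entry in the first t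
  columns to be alone in its whole row, not only within those columns. This is what keeps the
  finished columns intact when the next pivot row is cleared.\<close>

lemma reduce_column:
  fixes Y :: "'a::field mat"
  assumes Y: "reduced_upto m t Y" and t: "t < m"
  obtains a b where "a \<in> unitriangular m" "b \<in> unitriangular m" "reduced_upto m (Suc t) (a * Y * b)"
proof (cases "\<forall>i<m. Y $$ (i, t) = 0")
  case True
  have "reduced_upto m (Suc t) Y"
    unfolding reduced_upto_def
  proof (intro conjI allI impI)
    show "Y \<in> carrier_mat m m" using reduced_upto_carrier[OF Y] .
    fix j i k assume *: "j < Suc t" "i < m" "j < m \<and> Y $$ (i, j) \<noteq> 0" "k < m"
    then have "j \<noteq> t" using True by blast
    then have j: "j < t" using * by simp
    show "Y $$ (i, k) = 0" if "k \<noteq> j" using reduced_uptoD(1)[OF Y j, of i k] * that by simp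
    show "Y $$ (k, j) = 0" if "k \<noteq> i" using reduced_uptoD(2)[OF Y j, of i k] * that by simp
  qed
  moreover have "1\<^sub>m m * Y * 1\<^sub>m m = Y" using reduced_upto_carrier[OF Y] by simp
  ultimately show ?thesis using that[OF one_unitriangular one_unitriangular] by simp
next
  case False
  have Yc: "Y \<in> carrier_mat m m" using reduced_upto_carrier[OF Y] .
  have Yr: "Y $$ (i, k) = 0" if "j < t" "i < m" "Y $$ (i, j) \<noteq> 0" "k < m" "k \<noteq> j" for i j k
    using reduced_uptoD(1)[OF Y that(1) _ that(2-4)] that t by simp
  have Yl: "Y $$ (k, j) = 0" if "j < t" "i < m" "Y $$ (i, j) \<noteq> 0" "k < m" "k \<noteq> i" for i j k
    using reduced_uptoD(2)[OF Y that(1) _ that(2-4)] that t by simp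
  \<comment> \<open>Left multiplication by an upper unitriangular matrix adds lower rows to higher
    ones only, so the pivot must be the lowest nonzero entry of column t.\<close>
  define i where "i = Max {i. i < m \<and> Y $$ (i, t) \<noteq> 0}"
  have "i \<in> {i. i < m \<and> Y $$ (i, t) \<noteq> 0}"
    unfolding i_def using False by (intro Max_in) auto
  then have i: "i < m" "Y $$ (i, t) \<noteq> 0" by auto
  have below: "Y $$ (k, t) = 0" if "i < k" "k < m" for k
    using Max_ge[of "{i. i < m \<and> Y $$ (i, t) \<noteq> 0}" k] that unfolding i_def by fastforce
  \<comment> \<open>A nonzero entry of row i in an earlier column would be alone in its row by the
    invariant, against the pivot in column t.\<close>
  have left: "Y $$ (i, j) = 0" if "j < t" for j
    using Yr[of j i t] i t that by auto
  \<comment> \<open>a clears column t with the pivot row, b clears row i with the pivot column. Both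
    sums run over all other rows and columns; the factors are nevertheless upper unitriangular
    because the entries below and to the left of the pivot vanish.\<close>
  define a where "a = mat m m (\<lambda>(k, l). (if k = l then 1 else 0)
      - (if l = i \<and> k \<noteq> i then Y $$ (k, t) / Y $$ (i, t) else 0))"
  define b where "b = mat m m (\<lambda>(k, l). (if k = l then 1 else 0)
      - (if k = t \<and> l \<noteq> t then Y $$ (i, l) / Y $$ (i, t) else 0))"
  have a: "a \<in> unitriangular m"
    using below by (intro unitriangularI) (auto simp: a_def)
  have b: "b \<in> unitriangular m"
    using left by (intro unitriangularI) (auto simp: b_def)
  have aY: "(a * Y) $$ (k, l) = Y $$ (k, l) - (if k \<noteq> i then Y $$ (k, t) / Y $$ (i, t) * Y $$ (i, l) else 0)"
    if "k < m" "l < m" for k l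
  proof -
    have "(a * Y) $$ (k, l) = (\<Sum>h = 0..<m. a $$ (k, h) * Y $$ (h, l))"
      using index_mult_square[OF unitriangularD(1)[OF a] Yc that] .
    also have "\<dots> = (\<Sum>h = 0..<m. (if h = k then Y $$ (h, l) else 0)
        - (if h = i then (if k \<noteq> i then Y $$ (k, t) / Y $$ (i, t) * Y $$ (i, l) else 0) else 0))"
      using that by (intro sum.cong) (auto simp: a_def)
    finally show ?thesis using that i by (simp add: sum_subtractf)
  qed
  have ac: "a * Y \<in> carrier_mat m m" using unitriangularD(1)[OF a] Yc by simp
  have aYt: "(a * Y) $$ (k, t) = (if k = i then Y $$ (i, t) else 0)" if "k < m" for k
    using aY[of k t] i t that by simp
  \<comment> \<open>Away from the pivot row and column the result is the Schur complement of Y with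
    respect to the pivot.\<close>
  have aYb: "(a * Y * b) $$ (k, l) =
      (if l = t then if k = i then Y $$ (i, t) else 0
       else if k = i then 0 else Y $$ (k, l) - Y $$ (k, t) / Y $$ (i, t) * Y $$ (i, l))"
    if kl: "k < m" "l < m" for k l
  proof -
    have "(a * Y * b) $$ (k, l) = (\<Sum>h = 0..<m. (a * Y) $$ (k, h) * b $$ (h, l))"
      using index_mult_square[OF ac unitriangularD(1)[OF b] that] .
    also have "\<dots> = (\<Sum>h = 0..<m. (if h = l then (a * Y) $$ (k, l) else 0)
        - (if h = t then (if l \<noteq> t then (a * Y) $$ (k, t) * (Y $$ (i, l) / Y $$ (i, t)) else 0) else 0))"
      using that by (intro sum.cong) (auto simp: b_def)
    also have "\<dots> = (a * Y) $$ (k, l) - (if l \<noteq> t then (a * Y) $$ (k, t) * (Y $$ (i, l) / Y $$ (i, t)) else 0)"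
      using that t by (simp add: sum_subtractf)
    finally show ?thesis unfolding aY[OF kl] aYt[OF kl(1)] using i by simp
  qed
  \<comment> \<open>The correction in column l is a multiple of Y at (i, l), which vanishes for l <
    t.\<close>
  have aYb0: "(a * Y * b) $$ (k, l) = Y $$ (k, l)" if "k < m" "l < t" for k l
    using aYb[of k l] left[of l] that t by auto
  have "reduced_upto m (Suc t) (a * Y * b)"
    unfolding reduced_upto_def
  proof (intro conjI allI impI)
    show "a * Y * b \<in> carrier_mat m m" using ac unitriangularD(1)[OF b] by simp
    fix j k l
    assume j: "j < Suc t" and k: "k < m" and nz: "j < m \<and> (a * Y * b) $$ (k, j) \<noteq> 0" and l: "l < m"
    show "(a * Y * b) $$ (k, l) = 0" if "l \<noteq> j"
    proof (cases "j = t")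
      case True
      then have "k = i" using aYb[of k t] k nz t by (auto split: if_splits)
      then show ?thesis using aYb[of k l] k l that True by simp
    next
      case False
      then have jt: "j < t" using j by simp
      then have nz': "Y $$ (k, j) \<noteq> 0" using nz aYb0 k by simp
      then have "k \<noteq> i" using left jt by auto
      then show ?thesis
        using aYb[OF k l] Yr[OF jt k nz' l that] Yr[OF jt k nz' t] jt by auto
    qed
    show "(a * Y * b) $$ (l, j) = 0" if "l \<noteq> k"
    proof (cases "j = t")
      case True
      then have "k = i" using aYb[of k t] k nz t by (auto split: if_splits)
      then show ?thesis using aYb[of l t] l t that True by simp
    next
      case False
      then have jt: "j < t" using j by simp
      then show ?thesis using nz aYb0 Yl[OF jt k _ l that] k l by simp
    qed
  qed
  with a b that show ?thesis by blast
qed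

lemma monomial_exists:
  fixes X :: "'a::field mat"
  assumes X: "X \<in> carrier_mat m m"
  obtains a M b where "a \<in> unitriangular m" "b \<in> unitriangular m" "monomial_mat m M" "X = a * M * b"
proof -
  have "\<exists>a b. a \<in> unitriangular m \<and> b \<in> unitriangular m \<and> reduced_upto m t (a * X * b)" if "t \<le> m" for t
    using that
  proof (induction t)
    case 0
    have "reduced_upto m 0 (1\<^sub>m m * X * 1\<^sub>m m)" using X by (simp add: reduced_upto_def)
    then show ?case using one_unitriangular by blast
  next
    case (Suc t)
    then obtain a b where ab: "a \<in> unitriangular m" "b \<in> unitriangular m" "reduced_upto m t (a * X * b)"
      by auto
    obtain c d where cd: "c \<in> unitriangular m" "d \<in> unitriangular m"
      "reduced_upto m (Suc t) (c * (a * X * b) * d)"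
      using reduce_column[OF ab(3)] Suc.prems by auto
    have "c * (a * X * b) * d = (c * a) * X * (b * d)"
      using X ab(1,2)[THEN unitriangularD(1)] cd(1,2)[THEN unitriangularD(1)]
      by (simp add: assoc_mult_mat[of _ m m _ m _ m])
    with cd ab show ?case using mult_unitriangular by metis
  qed
  then obtain a b where ab: "a \<in> unitriangular m" "b \<in> unitriangular m" "reduced_upto m m (a * X * b)"
    by blast
  obtain a' where a': "a' \<in> unitriangular m" "a' * a = 1\<^sub>m m"
    using unitriangular_inverse[OF ab(1)] by metis
  obtain b' where b': "b' \<in> unitriangular m" "b * b' = 1\<^sub>m m"
    using unitriangular_inverse[OF ab(2)] by metis
  note c = ab(1,2)[THEN unitriangularD(1)] a'(1)[THEN unitriangularD(1)] b'(1)[THEN unitriangularD(1)]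
  have "a' * (a * X * b) * b' = (a' * a) * X * (b * b')"
    using X c by (simp add: assoc_mult_mat[of _ m m _ m _ m])
  then have "X = a' * (a * X * b) * b'" using a' b' X by simp
  with a' b' ab reduced_upto_monomial that show ?thesis by blast
qed

subsection \<open>The antiautomorphism defining the classical group\<close>

definition twist :: "family \<Rightarrow> nat \<Rightarrow> nat \<Rightarrow> 'a::ring_1" where
  "twist G n k = (if G = Sp \<and> n \<le> k then - 1 else 1)"

text \<open>Let T be the diagonal matrix of the signs \<open>twist\<close>, A the full antidiagonal
  matrix of size m and \<Omega> = T A. Then \<open>dagger\<close> sends X to \<Omega> X' \<Omega>'',
  where X' is the transpose of X and \<Omega>'' = A T is the inverse of \<Omega>. So it is the
  adjoint for the form with Gram matrix \<Omega>, which is symmetric in the orthogonal cases and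
  alternating for \<open>Sp\<close>.\<close>

definition dagger :: "family \<Rightarrow> nat \<Rightarrow> 'a::field mat \<Rightarrow> 'a mat" where
  "dagger G n X = mat (msize G n) (msize G n)
     (\<lambda>(i, j). twist G n i * twist G n j * X $$ (msize G n - Suc j, msize G n - Suc i))"

lemma msize_simps: "msize Sp n = 2 * n" "msize O_even n = 2 * n" "msize O_odd n = Suc (2 * n)"
  by (simp_all add: msize_def mid_def)

lemma twist_square: "twist G n k * twist G n k = 1"
  by (simp add: twist_def)

lemma twist_left_cancel: "twist G n k * (twist G n k * c) = c"
  by (simp add: twist_def)

lemma twist_nonzero: "twist G n k \<noteq> (0 :: 'a::field)"
  by (simp add: twist_def)

lemma twist_reverse:
  assumes "k < msize G n"
  shows "twist G n (msize G n - Suc k) = (if G = Sp then - twist G n k else twist G n k)"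
  using assms by (auto simp: twist_def msize_simps)

lemma dagger_carrier [simp]: "dagger G n X \<in> carrier_mat (msize G n) (msize G n)"
  by (simp add: dagger_def)

lemma index_dagger:
  "i < msize G n \<Longrightarrow> j < msize G n \<Longrightarrow> dagger G n X $$ (i, j) =
     twist G n i * twist G n j * X $$ (msize G n - Suc j, msize G n - Suc i)"
  by (simp add: dagger_def)

lemma dagger_mult:
  assumes X: "X \<in> carrier_mat (msize G n) (msize G n)" and Y: "Y \<in> carrier_mat (msize G n) (msize G n)"
  shows "dagger G n (X * Y) = dagger G n Y * dagger G n X"
proof (rule eq_matI)
  let ?m = "msize G n"
  fix i j assume "i < dim_row (dagger G n Y * dagger G n X)" "j < dim_col (dagger G n Y * dagger G n X)"
  then have ij: "i < ?m" "j < ?m" by (auto simp: dagger_def)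
  have "(dagger G n Y * dagger G n X) $$ (i, j) = (\<Sum>k = 0..<?m. dagger G n Y $$ (i, k) * dagger G n X $$ (k, j))"
    using ij by (intro index_mult_square) auto
  also have "\<dots> = (\<Sum>k = 0..<?m. twist G n i * twist G n j *
      (X $$ (?m - Suc j, ?m - Suc k) * Y $$ (?m - Suc k, ?m - Suc i)))"
    using ij by (intro sum.cong) (auto simp: index_dagger mult_ac twist_left_cancel)
  also have "\<dots> = (\<Sum>k = 0..<?m. twist G n i * twist G n j *
      (X $$ (?m - Suc j, k) * Y $$ (k, ?m - Suc i)))"
    by (rule sum.reindex_bij_witness[of _ "\<lambda>k. ?m - Suc k" "\<lambda>k. ?m - Suc k"]) auto
  also have "\<dots> = dagger G n (X * Y) $$ (i, j)"
    using ij by (simp add: index_dagger index_mult_square[OF X Y] sum_distrib_left del: index_mult_mat)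
  finally show "dagger G n (X * Y) $$ (i, j) = (dagger G n Y * dagger G n X) $$ (i, j)" by simp
qed (auto simp: dagger_def)

lemma dagger_unitriangular:
  assumes x: "x \<in> unitriangular (msize G n)"
  shows "dagger G n x \<in> unitriangular (msize G n)"
proof (rule unitriangularI)
  note X = unitriangularD[OF x]
  show "dagger G n x $$ (i, j) = 0" if "j < i" "i < msize G n" for i j
    using that X(2)[of "msize G n - Suc i" "msize G n - Suc j"] by (simp add: index_dagger)
  show "dagger G n x $$ (i, i) = 1" if "i < msize G n" for i
    using that X(3)[of "msize G n - Suc i"] by (simp add: index_dagger twist_square)
qed simp

lemma dagger_monomial:
  assumes M: "monomial_mat (msize G n) M"
  shows "monomial_mat (msize G n) (dagger G n M)"
  unfolding monomial_mat_def
proof (intro conjI allI impI)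
  let ?m = "msize G n"
  have nz: "M $$ (?m - Suc j, ?m - Suc i) \<noteq> 0"
    if "i < ?m" "j < ?m" "dagger G n M $$ (i, j) \<noteq> 0" for i j
    using that by (simp add: index_dagger)
  fix i j k assume *: "i < ?m" "j < ?m" "k < ?m"
  show "j = k" if "dagger G n M $$ (i, j) \<noteq> 0 \<and> dagger G n M $$ (i, k) \<noteq> 0"
  proof -
    have "?m - Suc j = ?m - Suc k"
      using monomial_matD(3)[OF M, of "?m - Suc j" "?m - Suc k" "?m - Suc i"] nz * that by simp
    then show ?thesis using * by linarith
  qed
  show "i = j" if "dagger G n M $$ (i, k) \<noteq> 0 \<and> dagger G n M $$ (j, k) \<noteq> 0"
  proof -
    have "?m - Suc i = ?m - Suc j"
      using monomial_matD(2)[OF M, of "?m - Suc k" "?m - Suc i" "?m - Suc j"] nz * that by simp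
    then show ?thesis using * by linarith
  qed
qed simp

lemma uminus_monomial:
  fixes M :: "'a::field mat"
  assumes M: "monomial_mat m M"
  shows "monomial_mat m (- M)"
proof -
  have c: "M \<in> carrier_mat m m" using monomial_matD(1)[OF M] .
  then have nz: "(- M) $$ (i, j) = 0 \<longleftrightarrow> M $$ (i, j) = 0" if "i < m" "j < m" for i j
    using that by auto
  show ?thesis
    unfolding monomial_mat_def
  proof (intro conjI allI impI)
    show "- M \<in> carrier_mat m m" using c by simp
    fix i j k assume *: "i < m" "j < m" "k < m"
    show "j = k" if "(- M) $$ (i, j) \<noteq> 0 \<and> (- M) $$ (i, k) \<noteq> 0"
      using monomial_matD(2)[OF M *] nz that * by simp
    show "i = j" if "(- M) $$ (i, k) \<noteq> 0 \<and> (- M) $$ (j, k) \<noteq> 0"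
      using monomial_matD(3)[OF M *] nz that * by simp
  qed
qed

section \<open>Products with the antidiagonal matrix and with stacked blocks\<close>

lemma antidiag_carrier [simp]: "antidiag n \<in> carrier_mat n n"
  by (simp add: antidiag_def)

lemma antidiag_mult:
  assumes "A \<in> carrier_mat n k" "i < n" "j < k"
  shows "(antidiag n * A) $$ (i, j) = A $$ (n - Suc i, j)"
proof -
  have "(antidiag n * A) $$ (i, j) = (\<Sum>h = 0..<n. antidiag n $$ (i, h) * A $$ (h, j))"
    using assms by (auto simp: scalar_prod_def antidiag_def)
  also have "\<dots> = (\<Sum>h = 0..<n. if h = n - Suc i then A $$ (h, j) else 0)"
    using assms by (intro sum.cong) (auto simp: antidiag_def)
  finally show ?thesis using assms by simp
qed

lemma mult_antidiag:
  assumes "A \<in> carrier_mat k n" "i < k" "j < n"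
  shows "(A * antidiag n) $$ (i, j) = A $$ (i, n - Suc j)"
proof -
  have "(A * antidiag n) $$ (i, j) = (\<Sum>h = 0..<n. A $$ (i, h) * antidiag n $$ (h, j))"
    using assms by (auto simp: scalar_prod_def antidiag_def)
  also have "\<dots> = (\<Sum>h = 0..<n. if h = n - Suc j then A $$ (i, h) else 0)"
    using assms by (intro sum.cong) (auto simp: antidiag_def)
  finally show ?thesis using assms by simp
qed

lemma antidiag_square: "antidiag n * antidiag n = 1\<^sub>m n"
proof (rule eq_matI)
  fix i j assume "i < dim_row (1\<^sub>m n)" "j < dim_col (1\<^sub>m n)"
  then show "(antidiag n * antidiag n) $$ (i, j) = (1\<^sub>m n :: 'a mat) $$ (i, j)"
    using antidiag_mult[OF antidiag_carrier, of i n j] by (auto simp: antidiag_def)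
qed (auto simp: antidiag_def)

lemma append_rows_mult:
  fixes A :: "'a::field mat"
  assumes "A \<in> carrier_mat n1 k" "B \<in> carrier_mat n2 k" "C \<in> carrier_mat k l"
  shows "(A @\<^sub>r B) * C = (A * C) @\<^sub>r (B * C)"
  using assms
  by (intro eq_matI) (auto simp: append_rows_def scalar_prod_def intro!: sum.cong)

lemma four_block_mult_append_rows:
  fixes A :: "'a::field mat"
  assumes A: "A \<in> carrier_mat n n" and B: "B \<in> carrier_mat n r"
    and P: "P \<in> carrier_mat n k" and Q: "Q \<in> carrier_mat r k"
  shows "four_block_mat A B (0\<^sub>m r n) (1\<^sub>m r) * (P @\<^sub>r Q) = (A * P + B * Q) @\<^sub>r Q"
proof -
  \<comment> \<open>A vertical stack is a four block matrix whose right-hand blocks have no columns,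
    so the general block product applies.\<close>
  have "four_block_mat A B (0\<^sub>m r n) (1\<^sub>m r) * four_block_mat P (0\<^sub>m n 0) Q (0\<^sub>m r 0) =
    four_block_mat (A * P + B * Q) (A * 0\<^sub>m n 0 + B * 0\<^sub>m r 0)
      (0\<^sub>m r n * P + 1\<^sub>m r * Q) (0\<^sub>m r n * 0\<^sub>m n 0 + 1\<^sub>m r * 0\<^sub>m r 0)"
    by (rule mult_four_block_mat[OF A B _ _ P _ Q]) auto
  then show ?thesis
    using A B P Q by (simp add: append_rows_def)
qed

lemma append_rows_add:
  fixes A :: "'a::field mat"
  assumes "A \<in> carrier_mat n1 k" "B \<in> carrier_mat n2 k" "C \<in> carrier_mat n1 k" "D \<in> carrier_mat n2 k"
  shows "(A @\<^sub>r B) + (C @\<^sub>r D) = (A + C) @\<^sub>r (B + D)"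
  using assms by (intro eq_matI) (auto simp: append_rows_def)

lemma append_rows_zero: "0\<^sub>m n1 k @\<^sub>r 0\<^sub>m n2 k = 0\<^sub>m (n1 + n2) k"
  by (intro eq_matI) (auto simp: append_rows_def)

section \<open>Elements of U are unitriangular and isometries of the form\<close>

abbreviation form_sign :: "family \<Rightarrow> 'a::ring_1" where
  "form_sign G \<equiv> (if G = Sp then - 1 else 1)"

text \<open>One equation covers the three families: for r = 0 the product of v with its transpose is
  zero, and for \<open>Sp\<close> the given condition is negated, which moves the sign to the
  transposed term.\<close>

lemma w_condition_sum:
  fixes v w :: "'a::field mat"
  assumes v: "v \<in> carrier_mat n (mid G)" and w: "w \<in> carrier_mat n n" and cond: "w_condition G n v w"
  shows "form_sign G \<cdot>\<^sub>m (antidiag n * transpose_mat w) + v * transpose_mat v + w * antidiag n = 0\<^sub>m n n"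
proof -
  define P Q V where PQV: "P = antidiag n * transpose_mat w" "Q = w * antidiag n" "V = v * transpose_mat v"
  have c: "P \<in> carrier_mat n n" "Q \<in> carrier_mat n n" "V \<in> carrier_mat n n"
    using v w by (auto simp: PQV intro!: mult_carrier_mat)
  have V: "V $$ (i, j) = 0" if "mid G = 0" "i < n" "j < n" for i j
    using v that by (simp add: PQV scalar_prod_def)
  have "form_sign G * P $$ (i, j) + V $$ (i, j) + Q $$ (i, j) = 0" if ij: "i < n" "j < n" for i j
  proof (cases G)
    case Sp
    then have "P - Q = 0\<^sub>m n n" using cond by (simp add: w_condition_def PQV)
    then have "(P - Q) $$ (i, j) = 0" using that by simp
    then show ?thesis using Sp c ij V[OF _ ij] by (simp add: mid_def)
  next
    case O_even
    then have "P + Q = 0\<^sub>m n n" using cond by (simp add: w_condition_def PQV)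
    then have "(P + Q) $$ (i, j) = 0" using that by simp
    then show ?thesis using O_even c ij V[OF _ ij] by (simp add: mid_def)
  next
    case O_odd
    then have "P + Q = - V" using cond by (simp add: w_condition_def PQV)
    then have "(P + Q) $$ (i, j) = (- V) $$ (i, j)" by simp
    then have "P $$ (i, j) + Q $$ (i, j) = - V $$ (i, j)" using c ij by simp
    then have "P $$ (i, j) + V $$ (i, j) + Q $$ (i, j) = - V $$ (i, j) + V $$ (i, j)"
      by (metis add.assoc add.commute)
    then show ?thesis using O_odd by simp
  qed
  then show ?thesis
    unfolding PQV[symmetric] using c by (intro eq_matI) auto
qed

text \<open>The image of \<open>block_elt\<close> under \<open>dagger\<close>, with c the sign of
  the form; it turns out to be the inverse. Compared with \<open>block_elt\<close>, x and y change
  places. The upper right block is kept as a transpose of \<open>x * w\<close>, so that the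
  condition on w applies to the product without rewriting.\<close>

definition block_dagger ::
  "nat \<Rightarrow> nat \<Rightarrow> 'a \<Rightarrow> 'a::field mat \<Rightarrow> 'a mat \<Rightarrow> 'a mat \<Rightarrow> 'a mat \<Rightarrow> 'a mat" where
  "block_dagger n r c x y v w =
     four_block_mat (four_block_mat y (- v) (0\<^sub>m r n) (1\<^sub>m r))
       ((c \<cdot>\<^sub>m (antidiag n * transpose_mat (x * w) * antidiag n)) @\<^sub>r (transpose_mat (x * v) * antidiag n))
       (0\<^sub>m n (n + r)) (antidiag n * transpose_mat x * antidiag n)"

lemma antidiag_transpose_antidiag_carrier:
  "A \<in> carrier_mat n n \<Longrightarrow> antidiag n * transpose_mat A * antidiag n \<in> carrier_mat n n"
  by (intro mult_carrier_mat[of _ n n]) simp_all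

lemma transpose_antidiag_carrier:
  "A \<in> carrier_mat n r \<Longrightarrow> transpose_mat A * antidiag n \<in> carrier_mat r n"
  by (intro mult_carrier_mat[of _ r n]) simp_all

lemma antidiag_transpose_antidiag:
  assumes "A \<in> carrier_mat n n" "i < n" "j < n"
  shows "(antidiag n * transpose_mat A * antidiag n) $$ (i, j) = A $$ (n - Suc j, n - Suc i)"
  using assms by (simp add: mult_antidiag[of _ n] antidiag_mult[of _ n n] mult_carrier_mat[of _ n n] del: index_mult_mat(1))

lemma transpose_antidiag:
  assumes "A \<in> carrier_mat n r" "i < r" "j < n"
  shows "(transpose_mat A * antidiag n) $$ (i, j) = A $$ (n - Suc j, i)"
  using assms by (simp add: mult_antidiag[of _ r] del: index_mult_mat(1))

lemma index_three_blocks: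
  fixes A B P Q E :: "'a::field mat"
  assumes A: "A \<in> carrier_mat n n" and B: "B \<in> carrier_mat n r" and P: "P \<in> carrier_mat n n"
    and Q: "Q \<in> carrier_mat r n" and E: "E \<in> carrier_mat n n"
    and kl: "k < n + r + n" "l < n + r + n"
  shows "four_block_mat (four_block_mat A B (0\<^sub>m r n) (1\<^sub>m r)) (P @\<^sub>r Q) (0\<^sub>m n (n + r)) E $$ (k, l) =
     (if k < n then if l < n then A $$ (k, l) else if l < n + r then B $$ (k, l - n) else P $$ (k, l - n - r)
      else if k < n + r then if l < n then 0 else if l < n + r then if k = l then 1 else 0
        else Q $$ (k - n, l - n - r)
      else if l < n + r then 0 else E $$ (k - n - r, l - n - r))"
proof -
  note d = A[THEN carrier_matD(1)] A[THEN carrier_matD(2)] B[THEN carrier_matD(1)] B[THEN carrier_matD(2)]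
    P[THEN carrier_matD(1)] P[THEN carrier_matD(2)] Q[THEN carrier_matD(1)] Q[THEN carrier_matD(2)]
    E[THEN carrier_matD(1)] E[THEN carrier_matD(2)]
  have hl: "\<not> l < n + r \<Longrightarrow> l - (n + r) < n" and hk: "\<not> k < n + r \<Longrightarrow> k - (n + r) < n" using kl by linarith+
  consider "k < n" "k < n + r" | "\<not> k < n" "k < n + r" | "\<not> k < n" "\<not> k < n + r" by linarith
  then show ?thesis
  proof cases
    case 1
    then show ?thesis using kl hl hk by (auto simp: append_rows_def d)
  next
    case 2
    then have "l < n + r \<Longrightarrow> \<not> l < n \<Longrightarrow> (k - n = l - n) = (k = l)" by auto
    then show ?thesis using 2 kl hl hk by (auto simp: append_rows_def d)
  next
    case 3
    then show ?thesis using kl hl hk by (auto simp: append_rows_def d)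
  qed
qed

lemma index_block_elt:
  fixes x y v w :: "'a::field mat"
  assumes x: "x \<in> carrier_mat n n" and y: "y \<in> carrier_mat n n"
    and v: "v \<in> carrier_mat n r" and w: "w \<in> carrier_mat n n"
    and kl: "k < n + r + n" "l < n + r + n"
  shows "block_elt n r x y v w $$ (k, l) =
     (if k < n then if l < n then x $$ (k, l) else if l < n + r then (x * v) $$ (k, l - n) else (x * w) $$ (k, l - n - r)
      else if k < n + r then if l < n then 0 else if l < n + r then if k = l then 1 else 0
        else - v $$ (n - Suc (l - n - r), k - n)
      else if l < n + r then 0 else y $$ (n - Suc (l - n - r), n - Suc (k - n - r)))"
proof -
  have c: "antidiag n * transpose_mat y * antidiag n \<in> carrier_mat n n" "transpose_mat v * antidiag n \<in> carrier_mat r n"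
    "x * w \<in> carrier_mat n n" "x * v \<in> carrier_mat n r"
    using assms by (auto intro!: mult_carrier_mat)
  show ?thesis
    unfolding block_elt_def index_three_blocks[OF x c(4) c(3) uminus_carrier_mat[OF c(2)] c(1) kl]
    using kl c(2)[THEN carrier_matD(1)] c(2)[THEN carrier_matD(2)]
    by (intro if_cong refl)
      (simp_all add: antidiag_transpose_antidiag[OF y] transpose_antidiag[OF v] del: index_mult_mat)
qed

lemma index_block_dagger:
  fixes x y v w :: "'a::field mat"
  assumes x: "x \<in> carrier_mat n n" and y: "y \<in> carrier_mat n n"
    and v: "v \<in> carrier_mat n r" and w: "w \<in> carrier_mat n n"
    and kl: "k < n + r + n" "l < n + r + n"
  shows "block_dagger n r c x y v w $$ (k, l) =
     (if k < n then if l < n then y $$ (k, l) else if l < n + r then - v $$ (k, l - n)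
        else c * (x * w) $$ (n - Suc (l - n - r), n - Suc k)
      else if k < n + r then if l < n then 0 else if l < n + r then if k = l then 1 else 0
        else (x * v) $$ (n - Suc (l - n - r), k - n)
      else if l < n + r then 0 else x $$ (n - Suc (l - n - r), n - Suc (k - n - r)))"
proof -
  have xw: "x * w \<in> carrier_mat n n" and xv: "x * v \<in> carrier_mat n r" using x v w by auto
  have c: "antidiag n * transpose_mat x * antidiag n \<in> carrier_mat n n"
    "antidiag n * transpose_mat (x * w) * antidiag n \<in> carrier_mat n n"
    "transpose_mat (x * v) * antidiag n \<in> carrier_mat r n"
    using antidiag_transpose_antidiag_carrier[OF x] antidiag_transpose_antidiag_carrier[OF xw]
      transpose_antidiag_carrier[OF xv] .
  show ?thesis
    unfolding block_dagger_def
      index_three_blocks[OF y uminus_carrier_mat[OF v] smult_carrier_mat[OF c(2)] c(3) c(1) kl]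
    using kl v[THEN carrier_matD(1)] v[THEN carrier_matD(2)] c(2)[THEN carrier_matD(1)] c(2)[THEN carrier_matD(2)]
    by (intro if_cong refl)
      (simp_all add: antidiag_transpose_antidiag[OF x] antidiag_transpose_antidiag[OF xw]
        transpose_antidiag[OF xv] del: index_mult_mat)
qed

lemma dagger_block_elt:
  fixes x y v w :: "'a::field mat"
  assumes x: "x \<in> carrier_mat n n" and y: "y \<in> carrier_mat n n"
    and v: "v \<in> carrier_mat n (mid G)" and w: "w \<in> carrier_mat n n"
  shows "dagger G n (block_elt n (mid G) x y v w) = block_dagger n (mid G) (form_sign G) x y v w"
proof (rule eq_matI)
  let ?r = "mid G"
  have m: "msize G n = n + ?r + n" by (simp add: msize_def)
  have sp: "?r = 0" if "G = Sp" using that by (simp add: mid_def)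
  have r: "?r \<le> 1" by (cases G) (simp_all add: mid_def)
  have bd: "block_dagger n ?r (form_sign G) x y v w \<in> carrier_mat (n + ?r + n) (n + ?r + n)"
    unfolding block_dagger_def
    by (rule four_block_carrier_mat[OF four_block_carrier_mat[OF y one_carrier_mat]
        antidiag_transpose_antidiag_carrier[OF x]])
  then show "dim_row (dagger G n (block_elt n ?r x y v w)) = dim_row (block_dagger n ?r (form_sign G) x y v w)"
    "dim_col (dagger G n (block_elt n ?r x y v w)) = dim_col (block_dagger n ?r (form_sign G) x y v w)"
    using m by (auto simp: dagger_def)
  fix i j
  assume "i < dim_row (block_dagger n ?r (form_sign G) x y v w)"
    "j < dim_col (block_dagger n ?r (form_sign G) x y v w)"
  then have ij: "i < n + ?r + n" "j < n + ?r + n" using bd by auto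
  define I J where IJ: "I = n + ?r + n - Suc i" "J = n + ?r + n - Suc j"
  \<comment> \<open>For an index k and its mirror K this records at once the block of each, the
    offset inside the block and the sign: reversal exchanges the two outer blocks and fixes the
    middle one, and \<open>twist\<close> is the form sign exactly on the last block. The middle
    block occurs only for \<open>O_odd\<close>, where that sign is 1. All pairs of blocks are then
    settled by rewriting.\<close>
  have reflect: "k < n \<and> k < n + ?r \<and> \<not> K < n \<and> \<not> K < n + ?r \<and> K - n - ?r = n - Suc k
        \<and> n - Suc (n - Suc k) = k \<and> twist G n k = (1 :: 'a)
      \<or> \<not> k < n \<and> k < n + ?r \<and> \<not> K < n \<and> K < n + ?r \<and> k = n \<and> K = n \<and> form_sign G = (1 :: 'a)
        \<and> twist G n n = (1 :: 'a)
      \<or> \<not> k < n \<and> \<not> k < n + ?r \<and> K < n \<and> K < n + ?r \<and> K = n - Suc (k - n - ?r)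
        \<and> twist G n k = (form_sign G :: 'a)"
    if "k < n + ?r + n" "K = n + ?r + n - Suc k" for k K
  proof -
    consider "k < n" | "n \<le> k" "k < n + ?r" | "n + ?r \<le> k" by linarith
    then show ?thesis
    proof cases
      case 1
      then have "n + ?r \<le> K" "K - n - ?r = n - Suc k" using that(2) by simp_all
      then show ?thesis using 1 by (simp add: twist_def)
    next
      case 2
      then have "k = n" "?r = 1" using r by linarith+
      moreover from this have "G \<noteq> Sp" using sp by auto
      ultimately show ?thesis using that by (simp add: twist_def)
    next
      case 3
      then obtain a where "k = n + ?r + a" using le_Suc_ex by blast
      then show ?thesis using that by (simp add: twist_def)
    qed
  qed
  have "dagger G n (block_elt n ?r x y v w) $$ (i, j) =
      twist G n i * twist G n j * block_elt n ?r x y v w $$ (J, I)"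
    using ij m by (simp add: index_dagger IJ)
  also have "\<dots> = block_dagger n ?r (form_sign G) x y v w $$ (i, j)"
  proof -
    have sign: "form_sign G * form_sign G = (1 :: 'a)" by simp
    have lt: "I < n + ?r + n" "J < n + ?r + n" using ij by (simp_all add: IJ)
    show ?thesis
      unfolding index_block_elt[OF x y v w lt(2,1)] index_block_dagger[OF x y v w ij]
      using reflect[OF ij(1) IJ(1)] reflect[OF ij(2) IJ(2)]
      by (elim disjE conjE) (simp_all only: if_True if_False sign mult_1_left mult_1_right mult_zero_right)
  qed
  finally show "dagger G n (block_elt n ?r x y v w) $$ (i, j) = block_dagger n ?r (form_sign G) x y v w $$ (i, j)" .
qed

text \<open>The upper right block is the only one that involves w. The three summands of its top
  part have the common left factor x and the common right factor \<open>xt * J\<close> (named A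
  below); between them stands the left-hand side of \<open>cond\<close>. The lower right block is 1
  because \<open>yt * xt\<close> is the transpose of \<open>x * y\<close>.\<close>

lemma block_elt_mult_block_dagger:
  fixes x y v w :: "'a::field mat"
  assumes x: "x \<in> carrier_mat n n" and y: "y \<in> carrier_mat n n"
    and v: "v \<in> carrier_mat n r" and w: "w \<in> carrier_mat n n"
    and xy: "x * y = 1\<^sub>m n"
    and cond: "c \<cdot>\<^sub>m (antidiag n * transpose_mat w) + v * transpose_mat v + w * antidiag n = 0\<^sub>m n n"
  shows "block_elt n r x y v w * block_dagger n r c x y v w = 1\<^sub>m (n + r + n)"
proof -
  let ?J = "antidiag n :: 'a mat"
  define J where "J = ?J"
  have J: "J \<in> carrier_mat n n" "J * J = 1\<^sub>m n" by (simp_all add: J_def antidiag_square)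
  define xt vt wt yt where t: "xt = transpose_mat x" "vt = transpose_mat v" "wt = transpose_mat w" "yt = transpose_mat y"
  have tc: "xt \<in> carrier_mat n n" "vt \<in> carrier_mat r n" "wt \<in> carrier_mat n n" "yt \<in> carrier_mat n n"
    using x y v w by (auto simp: t)
  have xvt: "transpose_mat (x * v) = vt * xt" "transpose_mat (x * w) = wt * xt"
    using x v w by (simp_all add: t transpose_mult)
  have ytxt: "yt * xt = 1\<^sub>m n"
    using transpose_mult[OF x y] xy by (simp add: t)
  let ?TL = "four_block_mat x (x * v) (0\<^sub>m r n) (1\<^sub>m r)"
  let ?TL' = "four_block_mat y (- v) (0\<^sub>m r n) (1\<^sub>m r)"
  let ?TR = "(x * w) @\<^sub>r (- (vt * J))"
  let ?TR' = "(c \<cdot>\<^sub>m (J * (wt * xt) * J)) @\<^sub>r (vt * xt * J)"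
  let ?BR = "J * yt * J" and ?BR' = "J * xt * J"
  have "block_elt n r x y v w * block_dagger n r c x y v w =
      four_block_mat ?TL ?TR (0\<^sub>m n (n + r)) ?BR * four_block_mat ?TL' ?TR' (0\<^sub>m n (n + r)) ?BR'"
    by (simp add: block_elt_def block_dagger_def xvt J_def t)
  also have "\<dots> = four_block_mat (?TL * ?TL' + ?TR * 0\<^sub>m n (n + r)) (?TL * ?TR' + ?TR * ?BR')
      (0\<^sub>m n (n + r) * ?TL' + ?BR * 0\<^sub>m n (n + r)) (0\<^sub>m n (n + r) * ?TR' + ?BR * ?BR')"
    using x y v w J tc
    by (intro mult_four_block_mat[of _ "n + r" "n + r" _ n _ n])
      (auto intro!: mult_carrier_mat[of _ _ n] carrier_append_rows four_block_carrier_mat)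
  also have "?TL * ?TL' = 1\<^sub>m (n + r)"
  proof -
    have "?TL * ?TL' = four_block_mat (x * y + x * v * 0\<^sub>m r n) (x * (- v) + x * v * 1\<^sub>m r)
        (0\<^sub>m r n * y + 1\<^sub>m r * 0\<^sub>m r n) (0\<^sub>m r n * (- v) + 1\<^sub>m r * 1\<^sub>m r)"
      using x y v by (intro mult_four_block_mat[of _ n n _ r _ r]) auto
    also have "x * (- v) + x * v * 1\<^sub>m r = 0\<^sub>m n r"
      using x v by (simp add: uminus_l_inv_mat[of _ n r])
    also have "0\<^sub>m r n * (- v) + 1\<^sub>m r * 1\<^sub>m r = 1\<^sub>m r"
      using v by (intro eq_matI) auto
    finally show ?thesis using xy x y v by simp
  qed
  also have "?TR * 0\<^sub>m n (n + r) = 0\<^sub>m (n + r) (n + r)"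
    using x w tc J by (intro right_mult_zero_mat carrier_append_rows) auto
  also have "?TL * ?TR' + ?TR * ?BR' = 0\<^sub>m (n + r) n"
  proof -
    define A where "A = xt * J"
    have A: "A \<in> carrier_mat n n" using tc J by (auto simp: A_def)
    have 1: "?TL * ?TR' = (x * (c \<cdot>\<^sub>m (J * (wt * xt) * J)) + x * v * (vt * xt * J)) @\<^sub>r (vt * xt * J)"
      using x v tc J by (intro four_block_mult_append_rows[of _ n _ r _ n]) (auto intro!: mult_carrier_mat[of _ _ n])
    have 2: "?TR * ?BR' = (x * w * ?BR') @\<^sub>r (- (vt * J) * ?BR')"
      using x w tc J by (intro append_rows_mult[of _ n n _ r _ n]) (auto intro!: mult_carrier_mat[of _ _ n])
    have 3: "vt * xt * J = vt * A" using tc J by (simp add: A_def)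
    have 4: "- (vt * J) * ?BR' = - (vt * A)"
    proof -
      have "- (vt * J) * ?BR' = - (vt * (J * J) * A)"
        using tc J(1) A by (simp add: A_def assoc_mult_mat[of _ _ n _ n _ n] uminus_mult_left_mat)
      then show ?thesis using J tc by simp
    qed
    have 5: "x * (c \<cdot>\<^sub>m (J * (wt * xt) * J)) + x * v * (vt * A) + x * w * ?BR' = 0\<^sub>m n n"
    proof -
      have e1: "x * (c \<cdot>\<^sub>m (J * (wt * xt) * J)) = x * (c \<cdot>\<^sub>m (J * wt)) * A"
        using x tc J(1) A
        by (simp add: A_def assoc_mult_mat[of _ _ n _ n _ n] mult_smult_distrib[of _ n n _ n]
            mult_smult_assoc_mat[of _ n n _ n])
      have e2: "x * v * (vt * A) = x * (v * vt) * A"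
        using x v tc A by (simp add: assoc_mult_mat[of _ n n _ r _ n] assoc_mult_mat[of _ n n _ n _ n]
            assoc_mult_mat[of _ n r _ n _ n])
      have e3: "x * w * ?BR' = x * (w * J) * A"
        using x w tc J(1) A by (simp add: A_def assoc_mult_mat[of _ n n _ n _ n])
      have add: "x * P * A + x * V * A + x * Q * A = x * (P + V + Q) * A"
        if "P \<in> carrier_mat n n" "V \<in> carrier_mat n n" "Q \<in> carrier_mat n n" for P V Q
      proof -
        have "x * (P + V + Q) = x * P + x * V + x * Q"
          using mult_add_distrib_mat[OF x add_carrier_mat[OF that(2), of P] that(3)]
            mult_add_distrib_mat[OF x that(1,2)] by simp
        then show ?thesis
          using add_mult_distrib_mat[of "x * P + x * V" n n "x * Q" A n]
            add_mult_distrib_mat[of "x * P" n n "x * V" A n] x A that by simp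
      qed
      have "x * (c \<cdot>\<^sub>m (J * (wt * xt) * J)) + x * v * (vt * A) + x * w * ?BR' =
          x * (c \<cdot>\<^sub>m (J * wt) + v * vt + w * J) * A"
        unfolding e1 e2 e3 using v w tc J(1)
        by (intro add smult_carrier_mat mult_carrier_mat[of _ n n _ n] mult_carrier_mat[of _ n r _ n])
      then show ?thesis using cond x A by (simp add: J_def t)
    qed
    have "?TL * ?TR' + ?TR * ?BR' =
        (x * (c \<cdot>\<^sub>m (J * (wt * xt) * J)) + x * v * (vt * A) + x * w * ?BR') @\<^sub>r (vt * A + - (vt * A))"
      unfolding 1 unfolding 2 unfolding 3 4 using x v w tc J A
      by (intro append_rows_add[of _ n n _ r] add_carrier_mat uminus_carrier_mat smult_carrier_mat
          mult_carrier_mat[of "x * v" n r] mult_carrier_mat[of x n n] mult_carrier_mat[of _ n n]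
          mult_carrier_mat[of _ r n])
    also have "vt * A + - (vt * A) = 0\<^sub>m r n"
    proof -
      have "B + - B = 0\<^sub>m r n" if "B \<in> carrier_mat r n" for B :: "'a mat"
        using that by (intro eq_matI) auto
      then show ?thesis using tc A by simp
    qed
    finally show ?thesis unfolding 5 by (simp add: append_rows_zero)
  qed
  also have "?BR * ?BR' = 1\<^sub>m n"
  proof -
    have "?BR * ?BR' = J * yt * (J * J) * xt * J"
      using J(1) tc by (simp add: assoc_mult_mat[of _ n n _ n _ n])
    also have "\<dots> = J * (yt * xt) * J"
      using J tc by (simp add: assoc_mult_mat[of _ n n _ n _ n])
    finally show ?thesis using J by (simp add: ytxt)
  qed
  also have "0\<^sub>m n (n + r) * ?TL' + ?BR * 0\<^sub>m n (n + r) = 0\<^sub>m n (n + r)"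
    using y tc J by (simp add: left_mult_zero_mat[of _ "n + r" "n + r"] right_mult_zero_mat[of _ n n])
  also have "0\<^sub>m n (n + r) * ?TR' + 1\<^sub>m n = 1\<^sub>m n"
  proof -
    have "?TR' \<in> carrier_mat (n + r) n" using J tc by (intro carrier_append_rows) auto
    then show ?thesis by simp
  qed
  finally show ?thesis by simp
qed

text \<open>In \<open>unip_group\<close> the matrix y is only required to be an inverse of x;
  uniqueness of inverses supplies its shape.\<close>

lemma inverse_unitriangular:
  fixes x :: "'a::field mat"
  assumes x: "x \<in> unitriangular n" and y: "y \<in> carrier_mat n n" and xy: "x * y = 1\<^sub>m n"
  shows "y \<in> unitriangular n"
proof -
  obtain x' where x': "x' \<in> unitriangular n" "x' * x = 1\<^sub>m n"
    using unitriangular_inverse[OF x] by metis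
  have "y = x' * x * y" using x' y by simp
  also have "\<dots> = x' * (x * y)"
    using unitriangularD(1)[OF x] unitriangularD(1)[OF x'(1)] y by simp
  also have "\<dots> = x'" using xy unitriangularD(1)[OF x'(1)] by simp
  finally show ?thesis using x'(1) by simp
qed

lemma unip_groupE:
  assumes "z \<in> unip_group G n"
  obtains x y v w where "z = block_elt n (mid G) x y v w" "x \<in> unitriangular n" "y \<in> unitriangular n"
    "x * y = 1\<^sub>m n" "v \<in> carrier_mat n (mid G)" "w \<in> carrier_mat n n" "w_condition G n v w"
proof -
  obtain x y v w where z: "z = block_elt n (mid G) x y v w" "x \<in> unitriangular n" "y \<in> carrier_mat n n"
    "inverts_mat x y" "v \<in> carrier_mat n (mid G)" "w \<in> carrier_mat n n" "w_condition G n v w"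
    using assms unfolding unip_group_def by blast
  moreover have "x * y = 1\<^sub>m n"
    using z(4) unitriangularD(1)[OF z(2)] by (simp add: inverts_mat_def)
  ultimately show ?thesis using that inverse_unitriangular by blast
qed

lemma unip_group_unitriangular:
  assumes "z \<in> unip_group G n"
  shows "z \<in> unitriangular (msize G n)"
proof -
  obtain x y v w where z: "z = block_elt n (mid G) x y v w" and x: "x \<in> unitriangular n"
    and y: "y \<in> unitriangular n" and vw: "v \<in> carrier_mat n (mid G)" "w \<in> carrier_mat n n"
    using unip_groupE[OF assms] by metis
  note X = unitriangularD[OF x] and Y = unitriangularD[OF y]
  have m: "msize G n = n + mid G + n" by (simp add: msize_def)
  show ?thesis
    unfolding m z
  proof (rule unitriangularI)
    show "block_elt n (mid G) x y v w \<in> carrier_mat (n + mid G + n) (n + mid G + n)"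
      unfolding block_elt_def
      by (rule four_block_carrier_mat[OF four_block_carrier_mat[OF X(1) one_carrier_mat]
          antidiag_transpose_antidiag_carrier[OF Y(1)]])
    show "block_elt n (mid G) x y v w $$ (i, j) = 0" if "j < i" "i < n + mid G + n" for i j
      using that X(2) Y(2) by (auto simp: index_block_elt[OF X(1) Y(1) vw] simp del: index_mult_mat(1))
    show "block_elt n (mid G) x y v w $$ (i, i) = 1" if "i < n + mid G + n" for i
      using that X(3) Y(3) by (auto simp: index_block_elt[OF X(1) Y(1) vw] simp del: index_mult_mat(1))
  qed
qed

text \<open>Together with \<open>unip_group_unitriangular\<close> this is all that the later
  argument takes from the block description of U.\<close>

lemma unip_group_dagger:
  assumes "z \<in> unip_group G n"
  shows "z * dagger G n z = 1\<^sub>m (msize G n)"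
proof -
  obtain x y v w where z: "z = block_elt n (mid G) x y v w" and xy: "x \<in> unitriangular n"
    "y \<in> unitriangular n" "x * y = 1\<^sub>m n"
    and vw: "v \<in> carrier_mat n (mid G)" "w \<in> carrier_mat n n" "w_condition G n v w"
    using unip_groupE[OF assms] by metis
  show ?thesis
    unfolding z dagger_block_elt[OF xy(1,2)[THEN unitriangularD(1)] vw(1,2)]
      block_elt_mult_block_dagger[OF xy(1,2)[THEN unitriangularD(1)] vw(1,2) xy(3) w_condition_sum[OF vw]]
    by (simp add: msize_def mult_2 add_ac)
qed

section \<open>Skewness and strict triangularity of the monomial representative\<close>

lemma dagger_monomial_eq_uminus:
  fixes z M :: "'a::field mat"
  assumes z: "z \<in> unip_group G n"
    and a: "a \<in> unitriangular (msize G n)" and b: "b \<in> unitriangular (msize G n)"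
    and M: "monomial_mat (msize G n) M" and zM: "z - 1\<^sub>m (msize G n) = a * M * b"
  shows "dagger G n M = - M"
proof -
  let ?m = "msize G n" and ?d = "dagger G n"
  note zu = unip_group_unitriangular[OF z]
  obtain a' where a': "a' \<in> unitriangular ?m" "a' * a = 1\<^sub>m ?m"
    using unitriangular_inverse[OF a] by metis
  obtain d where d: "d \<in> unitriangular ?m" "?d a * d = 1\<^sub>m ?m"
    using unitriangular_inverse[OF dagger_unitriangular[OF a]] by metis
  note c = unitriangularD(1)[OF a] unitriangularD(1)[OF b] unitriangularD(1)[OF a'(1)]
    unitriangularD(1)[OF d(1)] unitriangularD(1)[OF zu] monomial_matD(1)[OF M]
    dagger_carrier[of G n a] dagger_carrier[of G n b] dagger_carrier[of G n M] dagger_carrier[of G n z]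
  have neg: "- X * Y = - (X * Y)" "X * - Y = - (X * Y)"
    if "X \<in> carrier_mat ?m ?m" "Y \<in> carrier_mat ?m ?m" for X Y :: "'a mat"
    using carrier_matD[OF that(1)] carrier_matD[OF that(2)] by auto
  \<comment> \<open>Since \<dagger> is additive and fixes 1, the image of z - 1 is
    \<open>?d z - 1\<^sub>m ?m\<close>; and \<open>z * ?d z = 1\<^sub>m ?m\<close> gives
    \<open>(z - 1\<^sub>m ?m) * ?d z = 1\<^sub>m ?m - ?d z\<close>.\<close>
  have "?d (z - 1\<^sub>m ?m) = ?d z - 1\<^sub>m ?m"
    using c by (intro eq_matI) (auto simp: index_dagger twist_square dagger_def right_diff_distrib)
  also have "\<dots> = - ((z - 1\<^sub>m ?m) * ?d z)"
  proof -
    have "(z - 1\<^sub>m ?m) * ?d z = 1\<^sub>m ?m - ?d z"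
      using minus_mult_distrib_mat[OF c(5) one_carrier_mat dagger_carrier] unip_group_dagger[OF z]
        left_mult_one_mat[OF dagger_carrier[of G n z]] by simp
    then show ?thesis by (intro eq_matI) (auto simp: dagger_def)
  qed
  finally have "?d (a * M * b) = - (a * M * b * ?d z)" by (simp add: zM)
  moreover have "?d (a * M * b) = ?d b * ?d M * ?d a"
    using c by (simp add: dagger_mult[of _ G n] assoc_mult_mat[of _ ?m ?m _ ?m _ ?m] del: dagger_carrier)
  ultimately have eq: "?d b * ?d M * ?d a = - (a * M * b * ?d z)" by simp
  \<comment> \<open>Cancelling a on the left and \<open>?d a\<close> on the right leaves one
    unitriangular factor on each side, the form that \<open>monomial_unique\<close>
    compares.\<close>
  have "a' * ?d b * ?d M = a' * (?d b * ?d M * (?d a * d))"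
    using c d by (simp add: right_mult_one_mat[of _ ?m ?m] assoc_mult_mat[of _ ?m ?m _ ?m _ ?m] del: dagger_carrier)
  also have "\<dots> = a' * (?d b * ?d M * ?d a) * d"
    using c by (simp add: assoc_mult_mat[of _ ?m ?m _ ?m _ ?m] del: dagger_carrier)
  also have "\<dots> = - (a' * (a * M * b * ?d z) * d)"
    unfolding eq using c by (simp add: neg del: dagger_carrier)
  also have "a' * (a * M * b * ?d z) * d = (a' * a) * M * (b * ?d z * d)"
    using c by (simp add: assoc_mult_mat[of _ ?m ?m _ ?m _ ?m] del: dagger_carrier)
  also have "- ((a' * a) * M * (b * ?d z * d)) = - M * (b * ?d z * d)"
    using c a' by (simp add: neg del: dagger_carrier)
  finally have "a' * ?d b * ?d M = - M * (b * ?d z * d)" .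
  moreover have "a' * ?d b \<in> unitriangular ?m" "b * ?d z * d \<in> unitriangular ?m"
    using a' b d zu mult_unitriangular dagger_unitriangular by blast+
  ultimately show ?thesis
    using monomial_unique dagger_monomial[OF M] uminus_monomial[OF M] by blast
qed

text \<open>Solving for M writes it as \<open>a' * z * b' - a' * b'\<close>, a difference of two
  unitriangular matrices, whose diagonals and lower parts cancel.\<close>

lemma monomial_strictly_upper:
  fixes z M :: "'a::field mat"
  assumes z: "z \<in> unitriangular m" and a: "a \<in> unitriangular m" and b: "b \<in> unitriangular m"
    and M: "M \<in> carrier_mat m m" and zM: "z - 1\<^sub>m m = a * M * b"
    and ij: "j \<le> i" "i < m"
  shows "M $$ (i, j) = 0"
proof -
  obtain a' where a': "a' \<in> unitriangular m" "a' * a = 1\<^sub>m m"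
    using unitriangular_inverse[OF a] by metis
  obtain b' where b': "b' \<in> unitriangular m" "b * b' = 1\<^sub>m m"
    using unitriangular_inverse[OF b] by metis
  note c = unitriangularD(1)[OF a] unitriangularD(1)[OF b] unitriangularD(1)[OF a'(1)]
    unitriangularD(1)[OF b'(1)] unitriangularD(1)[OF z] M
  have "M = (a' * a) * M * (b * b')" using a' b' M by simp
  also have "\<dots> = a' * (a * M * b) * b'"
    using c by (simp add: assoc_mult_mat[of _ m m _ m _ m])
  also have "\<dots> = a' * z * b' - a' * b'"
    unfolding zM[symmetric] using c
    by (simp add: mult_minus_distrib_mat[of _ m m _ m] minus_mult_distrib_mat[of _ m m _ _ m])
  finally have eq: "M = a' * z * b' - a' * b'" .
  have u: "a' * z * b' \<in> unitriangular m" "a' * b' \<in> unitriangular m"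
    using a' b' z mult_unitriangular by blast+
  have "(A - B) $$ (i, j) = 0" if "A \<in> unitriangular m" "B \<in> unitriangular m" for A B :: "'a mat"
  proof -
    note A = unitriangularD[OF that(1)] and B = unitriangularD[OF that(2)]
    have "(A - B) $$ (i, j) = A $$ (i, j) - B $$ (i, j)"
      using ij A(1) B(1) by auto
    then show ?thesis
      using ij A(2)[of j i] A(3)[of i] B(2)[of j i] B(3)[of i] by (cases "i = j") auto
  qed
  from this[OF u] show ?thesis by (simp only: eq)
qed

subsection \<open>Roots and positions\<close>

text \<open>
  \<open>corner G n \<alpha>\<close> is the entry of \<open>\<alpha>\<close> on or above the antidiagonal, as a pair of positions counted
  from 0; \<open>root_orbit G n \<alpha>\<close> then consists of the positions of all the entries of \<open>\<alpha>\<close>.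
\<close>

fun corner :: "family \<Rightarrow> nat \<Rightarrow> root \<Rightarrow> nat \<times> nat" where
  "corner G n (EpsMinus i j) = (nat (i - 1), nat (j - 1))"
| "corner G n (EpsPlus i j) = (nat (i - 1), msize G n - nat j)"
| "corner G n (TwoEps i) = (nat (i - 1), msize G n - nat i)"
| "corner G n (Eps i) = (nat (i - 1), n)"

text \<open>The set of corners of roots: one position from each mirror pair above the main diagonal.
  A position on the antidiagonal is its own mirror image and belongs to a root only for
  \<open>Sp\<close>, namely to some \<open>TwoEps i\<close>.\<close>

definition upper_half :: "family \<Rightarrow> nat \<Rightarrow> (nat \<times> nat) set" where
  "upper_half G n = {(k, l). k < l \<and> k + l < msize G n \<and> (Suc (k + l) = msize G n \<longrightarrow> G = Sp)}"

text \<open>Inverse of \<open>corner\<close> on \<open>upper_half\<close>. Position n is the index 0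
  only for \<open>O_odd\<close>; in the other families it is already the index - n, whence the test
  on G.\<close>

definition corner_root :: "family \<Rightarrow> nat \<Rightarrow> nat \<times> nat \<Rightarrow> root" where
  "corner_root G n = (\<lambda>(k, l).
     if l < n then EpsMinus (int k + 1) (int l + 1)
     else if G = O_odd \<and> l = n then Eps (int k + 1)
     else if Suc (k + l) = msize G n then TwoEps (int k + 1)
     else EpsPlus (int k + 1) (int (msize G n) - int l))"

text \<open>On row and column indices this is (i, j) \<mapsto> (- j, - i), the reflection in the
  antidiagonal.\<close>

definition reflect :: "nat \<Rightarrow> nat \<times> nat \<Rightarrow> nat \<times> nat" where
  "reflect m = (\<lambda>(k, l). (m - Suc l, m - Suc k))"

definition root_orbit :: "family \<Rightarrow> nat \<Rightarrow> root \<Rightarrow> (nat \<times> nat) set" where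
  "root_orbit G n \<alpha> = {corner G n \<alpha>, reflect (msize G n) (corner G n \<alpha>)}"

lemma roots_iff:
  "EpsMinus i j \<in> roots G n \<longleftrightarrow> 1 \<le> i \<and> i < j \<and> j \<le> int n"
  "EpsPlus i j \<in> roots G n \<longleftrightarrow> 1 \<le> i \<and> i < j \<and> j \<le> int n"
  "TwoEps i \<in> roots G n \<longleftrightarrow> G = Sp \<and> 1 \<le> i \<and> i \<le> int n"
  "Eps i \<in> roots G n \<longleftrightarrow> G = O_odd \<and> 1 \<le> i \<and> i \<le> int n"
  by (cases G; auto simp: roots_def)+

lemma rootsE:
  assumes "\<alpha> \<in> roots G n"
  obtains i j where "\<alpha> = EpsMinus (int i + 1) (int j + 1)" "i < j" "j < n"
  | i j where "\<alpha> = EpsPlus (int i + 1) (int j + 1)" "i < j" "j < n"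
  | i where "\<alpha> = TwoEps (int i + 1)" "i < n" "G = Sp"
  | i where "\<alpha> = Eps (int i + 1)" "i < n" "G = O_odd"
proof (cases \<alpha>)
  case (EpsMinus i j)
  then have "1 \<le> i" "i < j" "j \<le> int n"
    using assms by (auto simp: roots_iff)
  with EpsMinus show ?thesis using that(1)[of "nat (i - 1)" "nat (j - 1)"] by auto
next
  case (EpsPlus i j)
  then have "1 \<le> i" "i < j" "j \<le> int n"
    using assms by (auto simp: roots_iff)
  with EpsPlus show ?thesis using that(2)[of "nat (i - 1)" "nat (j - 1)"] by auto
next
  case (TwoEps i)
  then have "1 \<le> i" "i \<le> int n" "G = Sp"
    using assms by (auto simp: roots_iff)
  with TwoEps show ?thesis using that(3)[of "nat (i - 1)"] by auto
next
  case (Eps i)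
  then have "1 \<le> i" "i \<le> int n" "G = O_odd"
    using assms by (auto simp: roots_iff)
  with Eps show ?thesis using that(4)[of "nat (i - 1)"] by auto
qed

lemma msize_ge: "2 * n \<le> msize G n" "msize G n \<le> Suc (2 * n)"
  by (cases G; simp add: msize_simps)+

lemma corner_upper_half: "\<alpha> \<in> roots G n \<Longrightarrow> corner G n \<alpha> \<in> upper_half G n"
  by (erule rootsE) (use msize_ge[where n = n and G = G] in \<open>auto simp: upper_half_def nat_add_distrib msize_simps\<close>)

lemma corner_root_roots: "kl \<in> upper_half G n \<Longrightarrow> corner_root G n kl \<in> roots G n"
  by (cases G) (auto simp: upper_half_def corner_root_def roots_iff msize_simps split: if_splits)

lemma corner_corner_root: "kl \<in> upper_half G n \<Longrightarrow> corner G n (corner_root G n kl) = kl"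
  by (cases G) (auto simp: upper_half_def corner_root_def msize_simps split: if_splits)

lemma corner_root_corner: "\<alpha> \<in> roots G n \<Longrightarrow> corner_root G n (corner G n \<alpha>) = \<alpha>"
  by (erule rootsE; cases G) (auto simp: corner_root_def nat_add_distrib msize_simps)

lemma finite_roots: "finite (roots G n)"
proof (rule inj_on_finite)
  show "inj_on (corner G n) (roots G n)"
    using corner_root_corner by (rule inj_on_inverseI)
  show "corner G n ` roots G n \<subseteq> {..<msize G n} \<times> {..<msize G n}"
    using corner_upper_half by (fastforce simp: upper_half_def)
qed simp

lemma root_orbit_strictly_upper:
  assumes "\<alpha> \<in> roots G n" "(k, l) \<in> root_orbit G n \<alpha>"
  shows "k < l" "l < msize G n"
  using corner_upper_half[OF assms(1)] assms(2)
  by (auto simp: root_orbit_def upper_half_def reflect_def)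

text \<open>Corners lie on or above the antidiagonal, so two of them can be mirror images of each
  other only on the antidiagonal, where the reflection is the identity. Hence any position of an
  orbit determines its corner.\<close>

lemma root_orbit_eq:
  assumes \<alpha>: "\<alpha> \<in> roots G n" and \<beta>: "\<beta> \<in> roots G n"
    and "kl \<in> root_orbit G n \<alpha>" "kl \<in> root_orbit G n \<beta>"
  shows "\<alpha> = \<beta>"
proof -
  obtain a b where a: "corner G n \<alpha> = (a, b)" by fastforce
  obtain c d where c: "corner G n \<beta> = (c, d)" by fastforce
  have "a < b" "a + b < msize G n" "c < d" "c + d < msize G n"
    using corner_upper_half[OF \<alpha>] corner_upper_half[OF \<beta>] by (auto simp: a c upper_half_def)
  then have "corner G n \<alpha> = corner G n \<beta>"
    using assms(3,4) by (auto simp: a c root_orbit_def reflect_def)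
  then show ?thesis
    using corner_root_corner[OF \<alpha>] corner_root_corner[OF \<beta>] by metis
qed

text \<open>A position on or above the antidiagonal is itself a corner; one below it is the mirror
  image of a corner.\<close>

lemma root_orbit_exists:
  assumes "k < l" "l < msize G n" "Suc (k + l) = msize G n \<longrightarrow> G = Sp"
  obtains \<alpha> where "\<alpha> \<in> roots G n" "(k, l) \<in> root_orbit G n \<alpha>"
proof (cases "k + l < msize G n")
  case True
  then have "(k, l) \<in> upper_half G n" using assms by (auto simp: upper_half_def)
  then show ?thesis
    using that[OF corner_root_roots] corner_corner_root by (metis insertI1 root_orbit_def)
next
  case False
  then have "reflect (msize G n) (k, l) \<in> upper_half G n"
    using assms by (auto simp: upper_half_def reflect_def)
  moreover have "(k, l) = reflect (msize G n) (reflect (msize G n) (k, l))"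
    using assms by (auto simp: reflect_def)
  ultimately show ?thesis
    using that[OF corner_root_roots] corner_corner_root by (metis insertI1 insertI2 root_orbit_def)
qed

section \<open>Entries of the root matrices\<close>

lemma pos_simps:
  "pos G n (int i + 1) = i" "pos G n 0 = n" "i < n \<Longrightarrow> pos G n (- int i - 1) = msize G n - Suc i"
  "i < n \<Longrightarrow> pos G n (- (int i + 1)) = msize G n - Suc i"
  using msize_ge[where n = n and G = G] by (auto simp: pos_def)

lemma e_root_carrier [simp]: "e_root G n \<alpha> \<in> carrier_mat (msize G n) (msize G n)"
  by (cases \<alpha>) (auto simp: e_unit_def)

lemma index_e_unit:
  "k < msize G n \<Longrightarrow> l < msize G n \<Longrightarrow>
    e_unit G n i j $$ (k, l) = (if k = pos G n i \<and> l = pos G n j then 1 else 0)"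
  by (simp add: e_unit_def)

lemma e_unit_dim [simp]: "dim_row (e_unit G n i j) = msize G n" "dim_col (e_unit G n i j) = msize G n"
  by (simp_all add: e_unit_def)

lemma reflect_eq_iff:
  assumes "k < m" "l < m" "a < m" "b < m"
  shows "reflect m (k, l) = (a, b) \<longleftrightarrow> k = m - Suc b \<and> l = m - Suc a"
  using assms by (auto simp: reflect_def)

text \<open>The sign conventions for all kinds of roots and all families amount to one rule: the
  entry at the mirror position is the one that makes the matrix skew for \<dagger>. For
  \<open>TwoEps i\<close> the two tests hold at the same position, and there the second value is 1
  as well.\<close>

lemma index_e_root:
  assumes "\<alpha> \<in> roots G n" "k < msize G n" "l < msize G n"
  shows "(e_root G n \<alpha> :: 'a::field mat) $$ (k, l) =
    (if (k, l) = corner G n \<alpha> then 1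
     else if reflect (msize G n) (k, l) = corner G n \<alpha> then - (twist G n k * twist G n l) else 0)"
  using assms(1)
proof (cases rule: rootsE)
  let ?m = "msize G n"
  note m = msize_ge[where n = n and G = G]
  have tw: "twist G n i = (1 :: 'a)" "twist G n (?m - Suc i) = (if G = Sp then - 1 else 1 :: 'a)" if "i < n" for i
    using that twist_reverse[of i G n, where 'a = 'a] m by (auto simp: twist_def)
  {
    case (1 i j)
    have c: "corner G n \<alpha> = (i, j)" using 1 by simp
    have lt: "i < ?m" "j < ?m" "i < n" "i \<noteq> ?m - Suc j" using 1 m by linarith+
    show ?thesis
      unfolding c reflect_eq_iff[OF assms(2,3) lt(1,2)]
      using 1 lt assms(2,3) tw[of i] tw[of j]
      by (auto simp: index_e_unit pos_simps)
  next
    case (2 i j)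
    have c: "corner G n \<alpha> = (i, ?m - Suc j)" using 2 by (simp add: nat_add_distrib)
    have lt: "i < ?m" "?m - Suc j < ?m" "i < n" "?m - Suc (?m - Suc j) = j" using 2 m by linarith+
    show ?thesis
      unfolding c reflect_eq_iff[OF assms(2,3) lt(1,2)] lt(4)
      using 2 lt assms(2,3) tw[of i] tw[of j]
      by (auto simp: index_e_unit pos_simps)
  next
    case (3 i)
    have c: "corner G n \<alpha> = (i, ?m - Suc i)" using 3 by (simp add: nat_add_distrib)
    have lt: "i < ?m" "?m - Suc i < ?m" "?m - Suc (?m - Suc i) = i" using 3 m by linarith+
    show ?thesis
      unfolding c reflect_eq_iff[OF assms(2,3) lt(1,2)] lt(3)
      using 3 lt assms(2,3)
      by (auto simp: index_e_unit pos_simps)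
  next
    case (4 i)
    have c: "corner G n \<alpha> = (i, n)" using 4 by simp
    have lt: "i < ?m" "n < ?m" "?m - Suc n = n" "i \<noteq> n" using 4 by (simp_all add: msize_simps)
    show ?thesis
      unfolding c reflect_eq_iff[OF assms(2,3) lt(1,2)] lt(3)
      using 4 lt assms(2,3)
      by (auto simp: index_e_unit pos_simps twist_def)
  }
qed

subsection \<open>Skew monomial matrices\<close>

lemma e_root_nonzero_iff:
  assumes "\<alpha> \<in> roots G n" "k < msize G n" "l < msize G n"
  shows "(e_root G n \<alpha> :: 'a::field mat) $$ (k, l) \<noteq> 0 \<longleftrightarrow> (k, l) \<in> root_orbit G n \<alpha>"
proof -
  obtain a b where c: "corner G n \<alpha> = (a, b)" by fastforce
  then have "a < msize G n" "b < msize G n"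
    using corner_upper_half[OF assms(1)] by (auto simp: upper_half_def)
  then show ?thesis
    unfolding index_e_root[OF assms] c root_orbit_def
    using reflect_eq_iff[OF assms(2,3), of a b] by (auto simp: reflect_def twist_nonzero)
qed

lemma corner_in_root_orbit: "corner G n \<alpha> \<in> root_orbit G n \<alpha>"
  by (simp add: root_orbit_def)

text \<open>Distinct roots have disjoint orbits, so only one summand is nonzero at the given
  position.\<close>

lemma index_e_pair:
  assumes D: "D \<subseteq> roots G n" and \<alpha>: "\<alpha> \<in> D" and kl: "(k, l) \<in> root_orbit G n \<alpha>"
  shows "e_pair G n D \<phi> $$ (k, l) = \<phi> \<alpha> * (e_root G n \<alpha> :: 'a::field mat) $$ (k, l)"
proof -
  have lt: "k < msize G n" "l < msize G n"
    using root_orbit_strictly_upper[OF _ kl] D \<alpha> by fastforce+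
  have "finite D" using D finite_roots finite_subset by blast
  have "e_pair G n D \<phi> $$ (k, l) = (\<Sum>\<beta>\<in>D. \<phi> \<beta> * e_root G n \<beta> $$ (k, l))"
    unfolding e_pair_def using lt by (auto intro!: sum.cong simp: carrier_matD[OF e_root_carrier])
  also have "\<dots> = (\<Sum>\<beta>\<in>{\<alpha>}. \<phi> \<beta> * e_root G n \<beta> $$ (k, l))"
  proof (rule sum.mono_neutral_right[OF \<open>finite D\<close>])
    show "\<forall>\<beta>\<in>D - {\<alpha>}. \<phi> \<beta> * e_root G n \<beta> $$ (k, l) = 0"
    proof
      fix \<beta> assume "\<beta> \<in> D - {\<alpha>}"
      then have "(k, l) \<notin> root_orbit G n \<beta>" "\<beta> \<in> roots G n"
        using root_orbit_eq[OF _ _ kl] \<alpha> D by blast+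
      then show "\<phi> \<beta> * e_root G n \<beta> $$ (k, l) = 0"
        using e_root_nonzero_iff[OF _ lt] mult_eq_0_iff by blast
    qed
  qed (use \<alpha> in auto)
  finally show ?thesis by simp
qed

lemma index_e_pair_zero:
  assumes D: "D \<subseteq> roots G n" and lt: "k < msize G n" "l < msize G n"
    and kl: "\<And>\<alpha>. \<alpha> \<in> D \<Longrightarrow> (k, l) \<notin> root_orbit G n \<alpha>"
  shows "(e_pair G n D \<phi> :: 'a::field mat) $$ (k, l) = 0"
proof -
  have "e_pair G n D \<phi> $$ (k, l) = (\<Sum>\<beta>\<in>D. \<phi> \<beta> * e_root G n \<beta> $$ (k, l))"
    unfolding e_pair_def using lt by (auto intro!: sum.cong simp: carrier_matD[OF e_root_carrier])
  also have "\<dots> = 0"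
  proof (intro sum.neutral ballI)
    fix \<beta> assume "\<beta> \<in> D"
    then show "\<phi> \<beta> * e_root G n \<beta> $$ (k, l) = 0"
      using kl D e_root_nonzero_iff[OF _ lt] mult_eq_0_iff by blast
  qed
  finally show ?thesis .
qed

lemma index_e_pair_corner:
  assumes D: "D \<subseteq> roots G n" and \<alpha>: "\<alpha> \<in> D"
  shows "(e_pair G n D \<phi> :: 'a::field mat) $$ corner G n \<alpha> = \<phi> \<alpha>"
proof -
  obtain a b where c: "corner G n \<alpha> = (a, b)" by fastforce
  then have lt: "a < msize G n" "b < msize G n"
    using corner_upper_half[of \<alpha> G n] D \<alpha> by (auto simp: upper_half_def)
  show ?thesis
    using index_e_pair[OF D \<alpha>, of a b \<phi>] index_e_root[OF _ lt, of \<alpha>, where 'a = 'a] corner_in_root_orbit[of G n \<alpha>]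
      D \<alpha> c by auto
qed

definition indices :: "family \<Rightarrow> nat \<Rightarrow> int set" where
  "indices G n = {i. \<bar>i\<bar> \<le> int n \<and> (i = 0 \<longrightarrow> G = O_odd)}"

text \<open>Injectivity needs the restriction to genuine indices: outside \<open>O_odd\<close> the
  value of \<open>pos\<close> at 0 coincides with that at - n.\<close>

lemma inj_on_pos: "inj_on (pos G n) (indices G n)"
proof (rule inj_onI)
  fix i j assume "i \<in> indices G n" "j \<in> indices G n" "pos G n i = pos G n j"
  then show "i = j"
    by (cases G) (auto simp: indices_def pos_def msize_simps split: if_splits)
qed

lemma entries_indices: "\<alpha> \<in> roots G n \<Longrightarrow> entries \<alpha> \<subseteq> indices G n \<times> indices G n"
  by (erule rootsE) (auto simp: indices_def)

text \<open>The bridge between the integer indices in \<open>basic\<close> and the matrix positions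
  in \<open>monomial_mat\<close>.\<close>

lemma pos_entries:
  assumes "\<alpha> \<in> roots G n"
  shows "map_prod (pos G n) (pos G n) ` entries \<alpha> = root_orbit G n \<alpha>"
  using assms
proof (cases rule: rootsE)
  note m = msize_ge[where n = n and G = G]
  {
    case (1 i j)
    then show ?thesis using m
      by (simp add: pos_simps root_orbit_def reflect_def)
  next
    case (2 i j)
    then have "i < n" "msize G n - Suc (msize G n - Suc j) = j" using m by linarith+
    then show ?thesis using 2
      by (simp add: pos_simps root_orbit_def reflect_def nat_add_distrib)
  next
    case (3 i)
    then have "msize G n - Suc (msize G n - Suc i) = i" using m by linarith
    then show ?thesis using 3
      by (simp add: pos_simps root_orbit_def reflect_def nat_add_distrib)
  next
    case (4 i)
    then have "msize G n - Suc n = n" by (simp add: msize_simps)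
    then show ?thesis using 4
      by (simp add: pos_simps root_orbit_def reflect_def)
  }
qed

lemma entries_of_indices:
  assumes "D \<subseteq> roots G n" "(i, j) \<in> entries_of D"
  shows "i \<in> indices G n" "j \<in> indices G n"
  using assms entries_indices unfolding entries_of_def by blast+

lemma pos_entries_of:
  assumes "D \<subseteq> roots G n"
  shows "map_prod (pos G n) (pos G n) ` entries_of D = (\<Union>\<alpha>\<in>D. root_orbit G n \<alpha>)"
proof -
  have "map_prod (pos G n) (pos G n) ` entries_of D = (\<Union>\<alpha>\<in>D. map_prod (pos G n) (pos G n) ` entries \<alpha>)"
    by (simp add: entries_of_def image_UN)
  also have "\<dots> = (\<Union>\<alpha>\<in>D. root_orbit G n \<alpha>)"
    using assms pos_entries[of _ G n] by (intro SUP_cong refl) blast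
  finally show ?thesis .
qed

lemma e_pair_nonzero_iff:
  assumes D: "D \<subseteq> roots G n" and \<phi>: "\<forall>\<alpha>\<in>D. \<phi> \<alpha> \<noteq> 0" and lt: "k < msize G n" "l < msize G n"
  shows "(e_pair G n D \<phi> :: 'a::field mat) $$ (k, l) \<noteq> 0 \<longleftrightarrow> (\<exists>\<alpha>\<in>D. (k, l) \<in> root_orbit G n \<alpha>)"
proof
  show "\<exists>\<alpha>\<in>D. (k, l) \<in> root_orbit G n \<alpha>" if "e_pair G n D \<phi> $$ (k, l) \<noteq> 0"
    using index_e_pair_zero[OF D lt] that by blast
  assume "\<exists>\<alpha>\<in>D. (k, l) \<in> root_orbit G n \<alpha>"
  then obtain \<alpha> where \<alpha>: "\<alpha> \<in> D" "(k, l) \<in> root_orbit G n \<alpha>" by blast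
  then have "e_root G n \<alpha> $$ (k, l) \<noteq> (0 :: 'a)"
    using e_root_nonzero_iff[OF subsetD[OF D] lt] by blast
  then show "e_pair G n D \<phi> $$ (k, l) \<noteq> 0"
    using index_e_pair[OF D \<alpha>, of \<phi>] \<phi> \<alpha>(1) by simp
qed

lemma basic_pairsD:
  assumes "(D, \<phi>) \<in> basic_pairs G n"
  shows "D \<subseteq> roots G n" "basic D" "\<forall>\<alpha>\<in>D. \<phi> \<alpha> \<noteq> 0" "\<phi> \<in> extensional D"
  using assms by (auto simp: basic_pairs_def PiE_def)

text \<open>The support of the matrix is the image of \<open>entries_of D\<close> under the
  injective map \<open>pos\<close>, so the two halves of \<open>basic\<close> become the row and
  column conditions.\<close>

lemma e_pair_monomial:
  fixes \<phi> :: "root \<Rightarrow> 'a::field"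
  assumes "(D, \<phi>) \<in> basic_pairs G n"
  shows "monomial_mat (msize G n) (e_pair G n D \<phi>)"
proof -
  note B = basic_pairsD[OF assms]
  have row: "j = k" if "(i, j) \<in> entries_of D" "(i, k) \<in> entries_of D" for i j k
    using B(2) that unfolding basic_def by blast
  have col: "i = j" if "(i, k) \<in> entries_of D" "(j, k) \<in> entries_of D" for i j k
    using B(2) that unfolding basic_def by blast
  have nz: "\<exists>i j. (i, j) \<in> entries_of D \<and> k = pos G n i \<and> l = pos G n j"
    if "k < msize G n" "l < msize G n" "e_pair G n D \<phi> $$ (k, l) \<noteq> 0" for k l
  proof -
    have "\<exists>\<alpha>\<in>D. (k, l) \<in> root_orbit G n \<alpha>"
      using iffD1[OF e_pair_nonzero_iff[OF B(1,3) that(1,2)] that(3)] .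
    then have "(k, l) \<in> map_prod (pos G n) (pos G n) ` entries_of D"
      unfolding pos_entries_of[OF B(1)] by simp
    then show ?thesis by auto
  qed
  show ?thesis
    unfolding monomial_mat_def
  proof (intro conjI allI impI)
    show "e_pair G n D \<phi> \<in> carrier_mat (msize G n) (msize G n)" by (simp add: e_pair_def)
    fix k l h assume lt: "k < msize G n" "l < msize G n" "h < msize G n"
    show "l = h" if ne: "e_pair G n D \<phi> $$ (k, l) \<noteq> 0 \<and> e_pair G n D \<phi> $$ (k, h) \<noteq> 0"
    proof -
      obtain i j where 1: "(i, j) \<in> entries_of D" "k = pos G n i" "l = pos G n j"
        using nz[OF lt(1,2)] ne by blast
      obtain i' j' where 2: "(i', j') \<in> entries_of D" "k = pos G n i'" "h = pos G n j'"
        using nz[OF lt(1,3)] ne by blast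
      have "i = i'"
        using inj_onD[OF inj_on_pos] 1 2 entries_of_indices[OF B(1)] by metis
      then show ?thesis using row 1 2 by blast
    qed
    show "k = l" if ne: "e_pair G n D \<phi> $$ (k, h) \<noteq> 0 \<and> e_pair G n D \<phi> $$ (l, h) \<noteq> 0"
    proof -
      obtain i j where 1: "(i, j) \<in> entries_of D" "k = pos G n i" "h = pos G n j"
        using nz[OF lt(1,3)] ne by blast
      obtain i' j' where 2: "(i', j') \<in> entries_of D" "l = pos G n i'" "h = pos G n j'"
        using nz[OF lt(2,3)] ne by blast
      have "j = j'"
        using inj_onD[OF inj_on_pos] 1 2 entries_of_indices[OF B(1)] by metis
      then show ?thesis using col 1 2 by blast
    qed
  qed
qed

text \<open>A root lies in D exactly if its corner is in the support, and the value there is that of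
  \<phi>. Outside D the two maps agree because they are extensional.\<close>

lemma e_pair_inj:
  fixes \<phi> \<psi> :: "root \<Rightarrow> 'a::field"
  assumes B: "(D, \<phi>) \<in> basic_pairs G n" and B': "(E, \<psi>) \<in> basic_pairs G n"
    and eq: "e_pair G n D \<phi> = e_pair G n E \<psi>"
  shows "D = E \<and> \<phi> = \<psi>"
proof -
  have sub: "\<alpha> \<in> E"
    if B: "(D, \<phi>) \<in> basic_pairs G n" and B': "(E, \<psi>) \<in> basic_pairs G n"
      and eq: "e_pair G n D \<phi> = e_pair G n E \<psi>" and \<alpha>: "\<alpha> \<in> D"
    for D E \<alpha> and \<phi> \<psi> :: "root \<Rightarrow> 'a"
  proof -
    note b = basic_pairsD[OF B] and b' = basic_pairsD[OF B']
    obtain k l where kl: "corner G n \<alpha> = (k, l)" by fastforce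
    then have lt: "k < msize G n" "l < msize G n"
      using corner_upper_half[of \<alpha> G n] b(1) \<alpha> by (auto simp: upper_half_def)
    have "e_pair G n E \<psi> $$ (k, l) \<noteq> 0"
      using index_e_pair_corner[OF b(1) \<alpha>, of \<phi>] b(3) \<alpha> eq kl by simp
    then obtain \<beta> where "\<beta> \<in> E" "(k, l) \<in> root_orbit G n \<beta>"
      using e_pair_nonzero_iff[OF b'(1,3) lt] by blast
    moreover from this have "\<alpha> = \<beta>"
      using root_orbit_eq[of \<alpha> G n \<beta> "(k, l)"] corner_in_root_orbit[of G n \<alpha>] kl b(1) b'(1) \<alpha> by auto
    ultimately show ?thesis by simp
  qed
  have "D = E" using sub[OF B B' eq] sub[OF B' B eq[symmetric]] by blast
  moreover have "\<phi> = \<psi>"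
  proof (rule extensionalityI)
    show "\<phi> \<in> extensional D" "\<psi> \<in> extensional D"
      using basic_pairsD(4)[OF B] basic_pairsD(4)[OF B'] \<open>D = E\<close> by simp_all
    show "\<phi> \<alpha> = \<psi> \<alpha>" if "\<alpha> \<in> D" for \<alpha>
      using index_e_pair_corner[OF basic_pairsD(1)[OF B] that, of \<phi>]
        index_e_pair_corner[OF basic_pairsD(1)[OF B'], of \<alpha> \<psi>] that \<open>D = E\<close> eq by simp
  qed
  ultimately show ?thesis ..
qed

text \<open>
  The only strictly upper positions outside the root orbits are the \<open>(i, - i)\<close> in the orthogonal case,
  where the antisymmetry gives \<open>2 * M = 0\<close>.
\<close>

lemma e_pair_exists:
  fixes M :: "'a::field mat"
  assumes M: "monomial_mat (msize G n) M" and upper: "\<And>i j. j \<le> i \<Longrightarrow> i < msize G n \<Longrightarrow> M $$ (i, j) = 0"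
    and skew: "dagger G n M = - M" and two: "(2 :: 'a) \<noteq> 0"
  obtains D \<phi> where "(D, \<phi>) \<in> basic_pairs G n" "M = e_pair G n D \<phi>"
proof -
  let ?m = "msize G n"
  note c = monomial_matD(1)[OF M]
  have skew_entry: "M $$ (k, l) = - (twist G n k * twist G n l * M $$ reflect ?m (k, l))"
    if "k < ?m" "l < ?m" for k l
  proof -
    have "dagger G n M $$ (k, l) = - M $$ (k, l)" unfolding skew using c that by auto
    then show ?thesis
      using that by (simp add: index_dagger reflect_def)
  qed
  \<comment> \<open>Skewness determines M on an orbit from its value at the corner, with the sign
    pattern of \<open>e_root\<close>.\<close>
  have entry: "M $$ (k, l) = M $$ corner G n \<alpha> * e_root G n \<alpha> $$ (k, l)"
    if "\<alpha> \<in> roots G n" "(k, l) \<in> root_orbit G n \<alpha>" for \<alpha> k l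
  proof -
    have lt: "k < ?m" "l < ?m"
      using root_orbit_strictly_upper[OF that] by auto
    have "(k, l) = corner G n \<alpha> \<or> reflect ?m (k, l) = corner G n \<alpha>"
      using e_root_nonzero_iff[OF that(1) lt, where 'a = 'a] that(2)
      unfolding index_e_root[OF that(1) lt] by (auto split: if_splits)
    then show ?thesis
      unfolding index_e_root[OF that(1) lt] using skew_entry[OF lt] by auto
  qed
  \<comment> \<open>By \<open>index_e_pair_corner\<close> this choice of D and \<phi> is
    forced.\<close>
  define D where "D = {\<alpha> \<in> roots G n. M $$ corner G n \<alpha> \<noteq> 0}"
  define \<phi> where "\<phi> = restrict (\<lambda>\<alpha>. M $$ corner G n \<alpha>) D"
  have D: "D \<subseteq> roots G n" by (auto simp: D_def)
  have nz: "M $$ (pos G n i, pos G n j) \<noteq> 0 \<and> pos G n i < ?m \<and> pos G n j < ?m"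
    if ij: "(i, j) \<in> entries_of D" for i j
  proof -
    have "(pos G n i, pos G n j) \<in> map_prod (pos G n) (pos G n) ` entries_of D"
      using ij by force
    then obtain \<alpha> where \<alpha>: "\<alpha> \<in> D" "(pos G n i, pos G n j) \<in> root_orbit G n \<alpha>"
      unfolding pos_entries_of[OF D] by blast
    then have r: "\<alpha> \<in> roots G n" using D by blast
    have lt: "pos G n i < ?m" "pos G n j < ?m"
      using root_orbit_strictly_upper[OF r \<alpha>(2)] by auto
    then show ?thesis
      using entry[OF r \<alpha>(2)] e_root_nonzero_iff[OF r lt, where 'a = 'a] \<alpha> by (auto simp: D_def)
  qed
  have "basic D"
    unfolding basic_def
  proof (intro conjI allI impI; elim conjE)
    fix i j k
    show "j = k" if ij: "(i, j) \<in> entries_of D" and ik: "(i, k) \<in> entries_of D"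
    proof -
      have "pos G n j = pos G n k"
        using monomial_matD(2)[OF M, of "pos G n i" "pos G n j" "pos G n k"] nz[OF ij] nz[OF ik] by blast
      then show ?thesis
        using inj_onD[OF inj_on_pos] entries_of_indices(2)[OF D ij] entries_of_indices(2)[OF D ik] by blast
    qed
    show "i = j" if ik: "(i, k) \<in> entries_of D" and jk: "(j, k) \<in> entries_of D"
    proof -
      have "pos G n i = pos G n j"
        using monomial_matD(3)[OF M, of "pos G n i" "pos G n j" "pos G n k"] nz[OF ik] nz[OF jk] by blast
      then show ?thesis
        using inj_onD[OF inj_on_pos] entries_of_indices(1)[OF D ik] entries_of_indices(1)[OF D jk] by blast
    qed
  qed
  then have "(D, \<phi>) \<in> basic_pairs G n"
    using D by (auto simp: basic_pairs_def \<phi>_def D_def)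
  moreover have "M = e_pair G n D \<phi>"
  proof (rule eq_matI)
    show "dim_row M = dim_row (e_pair G n D \<phi>)" "dim_col M = dim_col (e_pair G n D \<phi>)"
      using c by (auto simp: e_pair_def)
    fix k l assume "k < dim_row (e_pair G n D \<phi>)" "l < dim_col (e_pair G n D \<phi>)"
    then have lt: "k < ?m" "l < ?m" by (auto simp: e_pair_def)
    show "M $$ (k, l) = e_pair G n D \<phi> $$ (k, l)"
    proof (cases "\<exists>\<alpha>\<in>D. (k, l) \<in> root_orbit G n \<alpha>")
      case True
      then obtain \<alpha> where \<alpha>: "\<alpha> \<in> D" "(k, l) \<in> root_orbit G n \<alpha>" by blast
      then show ?thesis
        using index_e_pair[OF D \<alpha>, of \<phi>] entry[OF _ \<alpha>(2)] D by (auto simp: \<phi>_def)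
    next
      case False
      then have "e_pair G n D \<phi> $$ (k, l) = 0"
        using index_e_pair_zero[OF D lt] by blast
      moreover have "M $$ (k, l) = 0"
      proof (cases "\<exists>\<alpha>\<in>roots G n. (k, l) \<in> root_orbit G n \<alpha>")
        case True
        then obtain \<alpha> where \<alpha>: "\<alpha> \<in> roots G n" "(k, l) \<in> root_orbit G n \<alpha>" by blast
        with False have "M $$ corner G n \<alpha> = 0" by (auto simp: D_def)
        then show ?thesis using entry[OF \<alpha>] by simp
      next
        case nexists: False
        show ?thesis
        proof (cases "l \<le> k")
          case False
          \<comment> \<open>Otherwise \<open>root_orbit_exists\<close> would provide an orbit
            through (k, l).\<close>
          then have "Suc (k + l) = ?m" "G \<noteq> Sp"
            using nexists root_orbit_exists[of k l G n] lt by (metis not_le)+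
          moreover from this have "reflect ?m (k, l) = (k, l)" by (auto simp: reflect_def)
          ultimately have "M $$ (k, l) = - M $$ (k, l)"
            using skew_entry[OF lt] by (simp add: twist_def)
          then have "2 * M $$ (k, l) = 0" by (metis add.right_inverse mult_2)
          then show ?thesis using two by simp
        qed (use upper lt in auto)
      qed
      ultimately show ?thesis by simp
    qed
  qed
  ultimately show ?thesis using that by blast
qed

subsection \<open>Superclasses\<close>

text \<open>The characteristic of a finite field divides the number of its elements, so it is not 2
  if that number is odd.\<close>

lemma two_nonzero:
  assumes "odd (card (UNIV :: 'a::{field, finite} set))"
  shows "(2 :: 'a) \<noteq> 0"
proof
  assume "(2 :: 'a) = 0"
  then have "of_nat 2 = (0 :: 'a)" by simp
  then have "CHAR('a) dvd 2" by (simp only: of_nat_eq_0_iff_char_dvd)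
  moreover have "CHAR('a) dvd card (UNIV :: 'a set)" by (rule CHAR_dvd_CARD)
  ultimately show False
    using assms two_is_prime_nat unfolding prime_nat_iff by auto
qed

lemma superclass_exists:
  fixes z :: "'a::{field, finite} mat"
  assumes z: "z \<in> unip_group G n" and two: "(2 :: 'a) \<noteq> 0"
  shows "\<exists>P \<in> basic_pairs G n. z \<in> superclass G n (fst P) (snd P)"
proof -
  let ?m = "msize G n"
  note zu = unip_group_unitriangular[OF z]
  have "z - 1\<^sub>m ?m \<in> carrier_mat ?m ?m" by (rule minus_carrier_mat) simp
  then obtain a M b where ab: "a \<in> unitriangular ?m" "b \<in> unitriangular ?m"
    and M: "monomial_mat ?m M" and eq: "z - 1\<^sub>m ?m = a * M * b"
    using monomial_exists by metis
  obtain D \<phi> where P: "(D, \<phi>) \<in> basic_pairs G n" "M = e_pair G n D \<phi>"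
    using e_pair_exists[OF M _ dagger_monomial_eq_uminus[OF z ab M eq] two]
      monomial_strictly_upper[OF zu ab monomial_matD(1)[OF M] eq] by metis
  then have "z \<in> superclass G n D \<phi>"
    using z ab eq unfolding superclass_def double_orbit_def by blast
  with P(1) show ?thesis by force
qed

text \<open>Two factorisations of z - 1 with monomial middle factors rearrange to
  \<open>(c' * a) * ?M = ?N * (d * b')\<close>, so the middle factors agree by
  \<open>monomial_unique\<close>, and a basic pair is determined by its matrix.\<close>

lemma superclass_unique:
  fixes z :: "'a::field mat"
  assumes P: "(D, \<phi>) \<in> basic_pairs G n" "z \<in> superclass G n D \<phi>"
    and Q: "(E, \<psi>) \<in> basic_pairs G n" "z \<in> superclass G n E \<psi>"
  shows "D = E \<and> \<phi> = \<psi>"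
proof -
  let ?m = "msize G n" and ?M = "e_pair G n D \<phi>" and ?N = "e_pair G n E \<psi>"
  obtain a b where ab: "a \<in> unitriangular ?m" "b \<in> unitriangular ?m" "z - 1\<^sub>m ?m = a * ?M * b"
    using P(2) unfolding superclass_def double_orbit_def by blast
  obtain c d where cd: "c \<in> unitriangular ?m" "d \<in> unitriangular ?m" "z - 1\<^sub>m ?m = c * ?N * d"
    using Q(2) unfolding superclass_def double_orbit_def by blast
  obtain b' where b': "b' \<in> unitriangular ?m" "b * b' = 1\<^sub>m ?m"
    using unitriangular_inverse[OF ab(2)] by metis
  obtain c' where c': "c' \<in> unitriangular ?m" "c' * c = 1\<^sub>m ?m"
    using unitriangular_inverse[OF cd(1)] by metis
  note M = e_pair_monomial[OF P(1)] and N = e_pair_monomial[OF Q(1)]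
  note car = ab(1,2)[THEN unitriangularD(1)] cd(1,2)[THEN unitriangularD(1)] b'(1)[THEN unitriangularD(1)]
    c'(1)[THEN unitriangularD(1)] monomial_matD(1)[OF M] monomial_matD(1)[OF N]
  have "c' * a * ?M = c' * a * ?M * (b * b')"
    using car b' by (simp add: right_mult_one_mat[of _ ?m ?m])
  also have "\<dots> = c' * (a * ?M * b) * b'"
    using car by (simp add: assoc_mult_mat[of _ ?m ?m _ ?m _ ?m])
  also have "\<dots> = c' * (c * ?N * d) * b'"
    using ab(3) cd(3) by simp
  also have "\<dots> = (c' * c) * ?N * (d * b')"
    using car by (simp add: assoc_mult_mat[of _ ?m ?m _ ?m _ ?m])
  also have "\<dots> = ?N * (d * b')"
    using car c' by simp
  finally have "?M = ?N"
    using monomial_unique[OF mult_unitriangular[OF c'(1) ab(1)] mult_unitriangular[OF cd(2) b'(1)] M N]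
    by blast
  then show ?thesis using e_pair_inj[OF P(1) Q(1)] by blast
qed

theorem theorem3p6:
  fixes p e n :: nat and G :: family
  assumes "prime p" and "odd p" and "e \<ge> 1"
    and "card (UNIV :: 'a::{field, finite} set) = p ^ e"
    and "n \<ge> 1"
  shows "(\<forall>z \<in> (unip_group G n :: 'a mat set).
            \<exists>!P. P \<in> basic_pairs G n \<and> z \<in> superclass G n (fst P) (snd P))
       \<and> (unip_group G n :: 'a mat set) = (\<Union>(D, \<phi>) \<in> basic_pairs G n. superclass G n D \<phi>)
       \<and> disjoint_family_on (\<lambda>(D, \<phi> :: root \<Rightarrow> 'a). superclass G n D \<phi>) (basic_pairs G n)"
proof (intro conjI ballI)
  have "odd (card (UNIV :: 'a set))" using assms by simp
  then have two: "(2 :: 'a) \<noteq> 0" by (rule two_nonzero)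
  have unique: "P = Q"
    if "P \<in> basic_pairs G n" "z \<in> superclass G n (fst P) (snd P)"
      "Q \<in> basic_pairs G n" "z \<in> superclass G n (fst Q) (snd Q)"
    for P Q :: "root set \<times> (root \<Rightarrow> 'a)" and z
    using superclass_unique[of "fst P" "snd P" G n z "fst Q" "snd Q"] that by (simp add: prod_eq_iff)
  show "\<exists>!P. P \<in> basic_pairs G n \<and> z \<in> superclass G n (fst P) (snd P)"
    if "z \<in> unip_group G n" for z :: "'a mat"
    using superclass_exists[OF that two] unique by blast
  show "(unip_group G n :: 'a mat set) = (\<Union>(D, \<phi>) \<in> basic_pairs G n. superclass G n D \<phi>)"
  proof
    show "(unip_group G n :: 'a mat set) \<subseteq> (\<Union>(D, \<phi>) \<in> basic_pairs G n. superclass G n D \<phi>)"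
    proof
      fix z :: "'a mat" assume "z \<in> unip_group G n"
      from superclass_exists[OF this two]
      show "z \<in> (\<Union>(D, \<phi>) \<in> basic_pairs G n. superclass G n D \<phi>)" by fastforce
    qed
  qed (auto simp: superclass_def)
  show "disjoint_family_on (\<lambda>(D, \<phi> :: root \<Rightarrow> 'a). superclass G n D \<phi>) (basic_pairs G n)"
    unfolding disjoint_family_on_def
  proof (intro ballI impI)
    fix P Q :: "root set \<times> (root \<Rightarrow> 'a)"
    assume "P \<in> basic_pairs G n" "Q \<in> basic_pairs G n" "P \<noteq> Q"
    then show "(case P of (D, \<phi>) \<Rightarrow> superclass G n D \<phi>) \<inter> (case Q of (D, \<phi>) \<Rightarrow> superclass G n D \<phi>) = {}"
      using unique[of P _ Q] unfolding case_prod_beta by blast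
  qed
qed

end
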